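(* Let $\mathbb{C}''=\mathbb{C}\setminus\{0,1\}$. The hyperbolic metric $\lambda_{\mathbb{C}''}(z)\,|dz|$ is complete (for $\mathbb{C}''$). In particular, for any domain $G\subset\mathbb{C}$ with at least two boundary points (in $\mathbb{C}$), the hyperbolic metric $\lambda_G(z)\,|dz|$ is complete (for $G$).
   Context: A conformal pseudo-metric $\lambda(z)\,|dz|$ on a domain $G$ is given by a continuous function $\lambda:G\to[0,+\infty)$, $\lambda\not\equiv 0$; it is a conformal metric if $\lambda>0$ on $G$. For a continuous real-valued function $u$ near $z$, put $\Delta u(z)=\liminf_{r\to 0}\frac{4}{r^2}\left(\frac{1}{2\pi}\int_0^{2\pi}u(z+re^{it})\,dt-u(z)\right)$. Where $\lambda(z)>0$ the curvature is $\kappa_\lambda(z)=-\Delta(\log\lambda)(z)/\lambda(z)^2$. The pseudo-metric is an SK-metric on $G$ if $\kappa_\lambda\le -1$ wherever $\lambda>0$. Every domain $G\subset\mathbb{C}$ with at least two boundary points carries an SK-metric, and its hyperbolic metric is the maximal one: $\lambda_G(z)=\sup\{\lambda(z):\lambda(z)\,|dz|\text{ an SK-metric on }G\}$, which is a positive $C^2$ density with curvature identically $-1$. For a conformal metric $\lambda(z)\,|dz|$ on $G$, let $\mathrm{d}_\lambda(z_0,z_1)=\inf_\gamma\int_\gamma\lambda(z)\,|dz|$, the infimum over all (continuous, piecewise continuously differentiable) paths $\gamma$ in $G$ joining $z_0$ and $z_1$. The metric $\lambda(z)\,|dz|$ is complete (for $G$) if $\lim_{n\to\infty}\mathrm{d}_\lambda(z_n,z_0)=+\infty$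 for every sequence $(z_n)\subset G$ which leaves every compact subset of $G$ and for some (equivalently, every) point $z_0\in G$. *)

theory Defs
  imports "HOL-Analysis.Analysis"
begin

definition plane_domain :: "complex set \<Rightarrow> bool" where
  "plane_domain G \<longleftrightarrow> open G \<and> connected G \<and> G \<noteq> {}"

text \<open>
  A (pseudo-)metric on \<open>G\<close> is represented by its density, a function on the whole plane
  of which only the values on \<open>G\<close> matter.
\<close>

definition conformal_pseudo_metric :: "complex set \<Rightarrow> (complex \<Rightarrow> real) \<Rightarrow> bool" where
  "conformal_pseudo_metric G \<rho> \<longleftrightarrow>
     continuous_on G \<rho> \<and> (\<forall>z\<in>G. 0 \<le> \<rho> z) \<and> (\<exists>z\<in>G. \<rho> z \<noteq> 0)"

text \<open>
  The lower limit may be infinite, so the generalized Laplacian and the curvature are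
  extended real numbers.
\<close>

definition gen_laplacian :: "(complex \<Rightarrow> real) \<Rightarrow> complex \<Rightarrow> ereal" where
  "gen_laplacian u z =
     Liminf (at_right 0)
       (\<lambda>r::real. ereal (4 / r\<^sup>2 *
          (1 / (2 * pi) * integral {0..2 * pi} (\<lambda>t. u (z + of_real r * cis t)) - u z)))"

definition curvature :: "(complex \<Rightarrow> real) \<Rightarrow> complex \<Rightarrow> ereal" where
  "curvature \<rho> z = (- gen_laplacian (\<lambda>w. ln (\<rho> w)) z) / ereal ((\<rho> z)\<^sup>2)"

definition sk_metric :: "complex set \<Rightarrow> (complex \<Rightarrow> real) \<Rightarrow> bool" where
  "sk_metric G \<rho> \<longleftrightarrow>
     conformal_pseudo_metric G \<rho> \<and> (\<forall>z\<in>G. \<rho> z > 0 \<longrightarrow> curvature \<rho> z \<le> -1)"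

text \<open>
  The supremum is taken in \<^typ>\<open>real\<close>; when \<open>G\<close> is a domain with at least two boundary
  points and \<open>z \<in> G\<close>, the set is nonempty and bounded above.
\<close>

definition hyperbolic_metric :: "complex set \<Rightarrow> complex \<Rightarrow> real" where
  "hyperbolic_metric G z = Sup {\<rho> z |\<rho>. sk_metric G \<rho>}"

text \<open>
  The library's \<^const>\<open>valid_path\<close> only asks for a continuous derivative off a finite set,
  so the path may have infinite length near an exceptional parameter. Requiring
  in addition that the one-sided limits of the derivative exist gives precisely the continuous,
  piecewise continuously differentiable paths: by the mean value theorem, each piece is then
  continuously differentiable up to its end points.
\<close>

definition piecewise_C1_path :: "(real \<Rightarrow> complex) \<Rightarrow> bool" where
  "piecewise_C1_path \<gamma> \<longleftrightarrow>
     valid_path \<gamma> \<and>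
     (\<forall>t\<in>{0<..1}. \<exists>l. ((\<lambda>s. vector_derivative \<gamma> (at s)) \<longlongrightarrow> l) (at_left t)) \<and>
     (\<forall>t\<in>{0..<1}. \<exists>l. ((\<lambda>s. vector_derivative \<gamma> (at s)) \<longlongrightarrow> l) (at_right t))"

definition conformal_length :: "(complex \<Rightarrow> real) \<Rightarrow> (real \<Rightarrow> complex) \<Rightarrow> real" where
  "conformal_length \<rho> \<gamma> =
     integral {0..1} (\<lambda>t. \<rho> (\<gamma> t) * norm (vector_derivative \<gamma> (at t)))"

definition conformal_dist ::
  "complex set \<Rightarrow> (complex \<Rightarrow> real) \<Rightarrow> complex \<Rightarrow> complex \<Rightarrow> real" where
  "conformal_dist G \<rho> z0 z1 =
     Inf {conformal_length \<rho> \<gamma> |\<gamma>. piecewise_C1_path \<gamma> \<and> path_image \<gamma> \<subseteq> G \<and>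
            pathstart \<gamma> = z0 \<and> pathfinish \<gamma> = z1}"

text \<open>
  Completeness is asked for every base point \<open>z0 \<in> G\<close>; for a conformal metric on a domain
  this is the same as for some base point.
\<close>

definition complete_conformal_metric :: "complex set \<Rightarrow> (complex \<Rightarrow> real) \<Rightarrow> bool" where
  "complete_conformal_metric G \<rho> \<longleftrightarrow>
     (\<forall>z0\<in>G. \<forall>z :: nat \<Rightarrow> complex.
        (\<forall>n. z n \<in> G) \<and>
        (\<forall>K. compact K \<and> K \<subseteq> G \<longrightarrow> (\<forall>\<^sub>F n in sequentially. z n \<notin> K)) \<longrightarrow>
        filterlim (\<lambda>n. conformal_dist G \<rho> (z n) z0) at_top sequentially)"

end

theory Submission
  imports Defs
begin

text \<open>
  The hyperbolic density of \<open>G\<close> dominates every SK-density on \<open>G\<close>, so completeness follows once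
  \<open>G\<close> carries SK-densities that already make the boundary and infinity infinitely distant. Since
  positive SK-metrics restrict to subdomains, it suffices to find, for two distinct points \<open>p\<close> and \<open>q\<close>
  outside \<open>G\<close>, an SK-metric on the plane punctured at \<open>p\<close> and \<open>q\<close> with the right size near \<open>p\<close>
  and near infinity.

  The density \<open>\<tau>(z) = 1 / (r * (C + \<bar>ln r\<bar>))\<close> with \<open>r = norm (z - p)\<close> has that size. It is the
  hyperbolic density of a punctured disc inside the unit circle about \<open>p\<close>, and that of a punctured
  neighbourhood of infinity outside it; it has curvature \<open>-1\<close> except on the circle itself, where its
  logarithm has a concave kink. The second puncture provides the curvature that is missing there:
  a product \<open>\<sigma>\<close> of powers of the distances to \<open>p\<close> and \<open>q\<close> is an SK-density on the whole
  twice punctured plane, and for large \<open>C\<close> it exceeds \<open>\<tau>\<close> on the unit circle. A maximum of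
  SK-densities is an SK-density, because at each point the logarithm of the maximum is touched
  from below by the logarithm of the larger one. Hence \<open>max \<sigma> \<tau>\<close> is the required metric
  (\<open>exists_sk_metric_twice_punctured\<close>). The function \<open>ln (C\<^sup>2 + (ln r)\<^sup>2) / 3\<close> has gradient at most
  \<open>\<tau>\<close>, so its increments bound the hyperbolic distance from below
  (\<open>hyperbolic_dist_ge_escape_potential\<close>), and it tends to infinity at \<open>p\<close> and at infinity.

  Two points about suprema and integrals remain. The supremum defining the hyperbolic density is
  finite by Ahlfors' lemma on discs (\<open>sk_metric_le_disc\<close>). The density is a supremum of continuous
  functions, so it is lower semicontinuous, and it is bounded on compact sets; this makes it
  integrable along every path.

  All generalized Laplacians are computed from second-order expansions (\<open>has_jet\<close>), which exist
  for every function built from \<open>(norm (z - p))\<^sup>2\<close> by sums and composition with smooth real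
  functions.
\<close>

section \<open>Second-order jets and the generalized Laplacian\<close>

text \<open>
  A second-order expansion of \<open>u\<close> at \<open>z\<close>: \<open>q\<close> is the Laplacian, and \<open>a\<close> is twice the
  \<open>\<partial>\<close>-derivative \<open>\<partial>u/\<partial>z\<close>, so \<open>norm a\<close> is the length of the gradient. The harmonic quadratic
  part \<open>Re (b * h\<^sup>2)\<close> is existentially quantified because it has mean zero on circles and
  so does not contribute to the Laplacian.
\<close>

definition has_jet :: "(complex \<Rightarrow> real) \<Rightarrow> complex \<Rightarrow> complex \<Rightarrow> real \<Rightarrow> bool" where
  "has_jet u z a q \<longleftrightarrow>
     (\<exists>b. ((\<lambda>h. (u (z + h) - u z - Re (a * h) - Re (b * h\<^sup>2) - q / 4 * (norm h)\<^sup>2) / (norm h)\<^sup>2)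
           \<longlongrightarrow> 0) (at 0))"

lemma has_jet_norm_sq: "has_jet (\<lambda>w. (norm (w - p))\<^sup>2) z (2 * cnj (z - p)) 4"
proof -
  have "(norm (z + h - p))\<^sup>2 - (norm (z - p))\<^sup>2 - Re (2 * cnj (z - p) * h) - Re (0 * h\<^sup>2)
      - 4 / 4 * (norm h)\<^sup>2 = 0" for h
    unfolding cmod_power2 by (simp add: algebra_simps power2_eq_square)
  then show ?thesis
    unfolding has_jet_def by (intro exI[of _ 0]) (simp del: mult_zero_left)
qed

lemma has_jet_add:
  assumes "has_jet u z a q" "has_jet v z a' q'"
  shows "has_jet (\<lambda>w. u w + v w) z (a + a') (q + q')"
proof -
  obtain b b' where
    "((\<lambda>h. (u (z + h) - u z - Re (a * h) - Re (b * h\<^sup>2) - q / 4 * (norm h)\<^sup>2) / (norm h)\<^sup>2) \<longlongrightarrow> 0) (at 0)"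
    "((\<lambda>h. (v (z + h) - v z - Re (a' * h) - Re (b' * h\<^sup>2) - q' / 4 * (norm h)\<^sup>2) / (norm h)\<^sup>2) \<longlongrightarrow> 0) (at 0)"
    using assms unfolding has_jet_def by blast
  from tendsto_add[OF this] show ?thesis
    unfolding has_jet_def
    by (intro exI[of _ "b + b'"]) (simp add: add_divide_distrib diff_divide_distrib algebra_simps)
qed

lemma has_jet_cong:
  assumes "\<forall>\<^sub>F w in nhds z. u w = v w" "has_jet u z a q"
  shows "has_jet v z a q"
proof -
  have eq: "u z = v z" using assms(1) eventually_nhds_x_imp_x by fast
  have "\<forall>\<^sub>F h in nhds 0. u (z + h) = v (z + h)"
    using assms(1) unfolding eventually_nhds_metric by (auto simp: dist_norm)
  then have ev: "\<forall>\<^sub>F h in at 0. u (z + h) = v (z + h)"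
    unfolding eventually_at_filter by eventually_elim simp
  obtain b where
    "((\<lambda>h. (u (z + h) - u z - Re (a * h) - Re (b * h\<^sup>2) - q / 4 * (norm h)\<^sup>2) / (norm h)\<^sup>2) \<longlongrightarrow> 0) (at 0)"
    using assms(2) unfolding has_jet_def by blast
  then have
    "((\<lambda>h. (v (z + h) - v z - Re (a * h) - Re (b * h\<^sup>2) - q / 4 * (norm h)\<^sup>2) / (norm h)\<^sup>2) \<longlongrightarrow> 0) (at 0)"
    by (rule Lim_transform_eventually) (use ev in eventually_elim, simp add: eq)
  then show ?thesis unfolding has_jet_def by blast
qed

text \<open>
  Peano's form of the remainder: the mean value theorem turns the first-order expansion of the
  derivative into the second-order expansion of the function.
\<close>

lemma second_order_taylor:
  fixes f :: "real \<Rightarrow> real"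
  assumes f: "\<forall>\<^sub>F y in nhds x. (f has_real_derivative f1 y) (at y)"
    and f1: "(f1 has_real_derivative f2) (at x)"
  shows "((\<lambda>t. (f (x + t) - f x - f1 x * t - f2 / 2 * t\<^sup>2) / t\<^sup>2) \<longlongrightarrow> 0) (at 0)"
proof (rule tendstoI)
  fix e :: real assume "e > 0"
  define g where "g t = f (x + t) - f x - f1 x * t - f2 / 2 * t\<^sup>2" for t
  obtain d1 where d1: "d1 > 0" "\<And>y. dist y x < d1 \<Longrightarrow> (f has_real_derivative f1 y) (at y)"
    using f unfolding eventually_nhds_metric by blast
  have "((\<lambda>t. (f1 (x + t) - f1 x) / t) \<longlongrightarrow> f2) (at 0)"
    using f1 by (simp add: DERIV_def)
  from tendstoD[OF this, of "e/2"] \<open>e > 0\<close>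
  obtain d2 where d2: "d2 > 0"
    "\<And>t. t \<noteq> 0 \<Longrightarrow> \<bar>t\<bar> < d2 \<Longrightarrow> \<bar>(f1 (x + t) - f1 x) / t - f2\<bar> < e / 2"
    unfolding eventually_at by (auto simp: dist_real_def)
  have small: "\<bar>f1 (x + t) - f1 x - f2 * t\<bar> \<le> e / 2 * \<bar>t\<bar>" if "\<bar>t\<bar> < d2" for t
  proof (cases "t = 0")
    case False
    have "f1 (x + t) - f1 x - f2 * t = ((f1 (x + t) - f1 x) / t - f2) * t"
      using False by (simp add: field_simps)
    then show ?thesis
      using mult_right_mono[OF less_imp_le[OF d2(2)[OF False that]], of "\<bar>t\<bar>"] by (simp only: abs_mult)
  qed simp
  show "\<forall>\<^sub>F t in at 0. dist ((f (x + t) - f x - f1 x * t - f2 / 2 * t\<^sup>2) / t\<^sup>2) 0 < e"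
    unfolding eventually_at
  proof (intro exI[of _ "min d1 d2"] conjI ballI impI)
    fix t :: real assume t: "t \<noteq> 0 \<and> dist t 0 < min d1 d2"
    have der: "(g has_real_derivative (f1 (x + s) - f1 x - f2 * s)) (at s within cball 0 \<bar>t\<bar>)"
      if "s \<in> cball 0 \<bar>t\<bar>" for s :: real
    proof -
      have "(f has_real_derivative f1 (x + s)) (at (x + s))"
        using that t by (intro d1(2)) (auto simp: dist_real_def)
      then have "((\<lambda>s. f (x + s)) has_real_derivative f1 (x + s)) (at s)"
        by (simp add: DERIV_shift add.commute)
      then have "((\<lambda>s. f (x + s) - f x - f1 x * s - f2 / 2 * s\<^sup>2) has_real_derivative
          f1 (x + s) - f1 x - f2 * s) (at s)"
        by (auto intro!: derivative_eq_intros)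
      then show ?thesis
        unfolding g_def by (rule has_field_derivative_at_within)
    qed
    have "norm (g t - g 0) \<le> (e / 2 * \<bar>t\<bar>) * norm (t - 0)"
    proof (rule field_differentiable_bound[OF convex_cball der])
      fix s :: real assume s: "s \<in> cball 0 \<bar>t\<bar>"
      then have "\<bar>f1 (x + s) - f1 x - f2 * s\<bar> \<le> e / 2 * \<bar>s\<bar>"
        using t by (intro small) auto
      also have "\<dots> \<le> e / 2 * \<bar>t\<bar>"
        using s \<open>e > 0\<close> by (intro mult_left_mono) auto
      finally show "norm (f1 (x + s) - f1 x - f2 * s) \<le> e / 2 * \<bar>t\<bar>" by simp
    qed auto
    then have "\<bar>g t\<bar> \<le> e / 2 * t\<^sup>2"
      by (simp add: g_def power2_eq_square)
    then have "\<bar>g t / t\<^sup>2\<bar> \<le> e / 2"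
      using t by (simp add: abs_divide divide_simps)
    then have "\<bar>g t / t\<^sup>2\<bar> < e" using \<open>e > 0\<close> by linarith
    then show "dist ((f (x + t) - f x - f1 x * t - f2 / 2 * t\<^sup>2) / t\<^sup>2) 0 < e"
      by (simp add: g_def)
  qed (use d1 d2 in auto)
qed

text \<open>
  The chain rule \<open>\<Delta>(f \<circ> u) = f'(u) \<Delta>u + f''(u) \<bar>\<nabla>u\<bar>\<^sup>2\<close>. It rests on
  \<open>(Re (a * h))\<^sup>2 = (norm a)\<^sup>2 * (norm h)\<^sup>2 / 2 + Re (a\<^sup>2 * h\<^sup>2) / 2\<close>, which splits the square of the
  linear part into a radial and a harmonic term.
\<close>

lemma has_jet_compose:
  assumes u: "has_jet u z a q"
    and f: "\<forall>\<^sub>F y in nhds (u z). (f has_real_derivative f1 y) (at y)"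
    and f1: "(f1 has_real_derivative f2) (at (u z))"
  shows "has_jet (\<lambda>w. f (u w)) z (of_real (f1 (u z)) * a) (f1 (u z) * q + f2 * (norm a)\<^sup>2)"
proof -
  define x where "x = u z"
  obtain b where b:
    "((\<lambda>h. (u (z + h) - u z - Re (a * h) - Re (b * h\<^sup>2) - q / 4 * (norm h)\<^sup>2) / (norm h)\<^sup>2) \<longlongrightarrow> 0) (at 0)"
    using u unfolding has_jet_def by blast
  define U where "U h = u (z + h) - u z" for h
  define e where "e h = (U h - Re (a * h) - Re (b * h\<^sup>2) - q / 4 * (norm h)\<^sup>2) / (norm h)\<^sup>2" for h
  define E where "E t = (if t = 0 then 0 else (f (x + t) - f x - f1 x * t - f2 / 2 * t\<^sup>2) / t\<^sup>2)" for t
  have e0: "(e \<longlongrightarrow> 0) (at 0)" using b unfolding e_def U_def .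
  have Re_bd: "\<bar>Re (c * w)\<bar> \<le> norm c * norm w" for c w
    using abs_Re_le_cmod[of "c * w"] by (simp add: norm_mult)
  have n0: "((\<lambda>h::complex. norm h) \<longlongrightarrow> 0) (at 0)"
    by (rule tendsto_norm_zero) (rule tendsto_ident_at)
  have Ueq: "U h = Re (a * h) + Re (b * h\<^sup>2) + q / 4 * (norm h)\<^sup>2 + e h * (norm h)\<^sup>2" if "h \<noteq> 0" for h
    using that by (simp add: e_def)
  \<comment> \<open>The increment agrees with its linear part up to \<open>o(norm h)\<close>, hence is \<open>O(norm h)\<close>.\<close>
  define V where "V h = (U h - Re (a * h)) / norm h" for h
  have V0: "(V \<longlongrightarrow> 0) (at 0)"
  proof (rule Lim_null_comparison)
    show "\<forall>\<^sub>F h in at 0. norm (V h) \<le> (norm b + \<bar>q\<bar> / 4 + \<bar>e h\<bar>) * norm h"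
      unfolding eventually_at_filter
    proof (intro always_eventually allI impI)
      fix h :: complex assume h: "h \<noteq> 0"
      have "\<bar>U h - Re (a * h)\<bar> = \<bar>Re (b * h\<^sup>2) + q / 4 * (norm h)\<^sup>2 + e h * (norm h)\<^sup>2\<bar>"
        using Ueq[OF h] by simp
      also have "\<dots> \<le> \<bar>Re (b * h\<^sup>2)\<bar> + \<bar>q / 4 * (norm h)\<^sup>2\<bar> + \<bar>e h * (norm h)\<^sup>2\<bar>" by linarith
      also have "\<dots> \<le> (norm b + \<bar>q\<bar> / 4 + \<bar>e h\<bar>) * norm h * norm h"
        using Re_bd[of b "h\<^sup>2"]
        by (simp del: times_complex.sel add: norm_power norm_mult abs_mult power2_eq_square algebra_simps)
      finally show "norm (V h) \<le> (norm b + \<bar>q\<bar> / 4 + \<bar>e h\<bar>) * norm h"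
        using h by (simp add: V_def abs_divide divide_simps)
    qed
    have "((\<lambda>h. (norm b + \<bar>q\<bar> / 4 + \<bar>e h\<bar>) * norm h) \<longlongrightarrow> (norm b + \<bar>q\<bar> / 4 + \<bar>0\<bar>) * 0) (at 0)"
      by (intro tendsto_intros e0 n0)
    then show "((\<lambda>h. (norm b + \<bar>q\<bar> / 4 + \<bar>e h\<bar>) * norm h) \<longlongrightarrow> 0) (at 0)" by simp
  qed
  \<comment> \<open>The linear part is only bounded after division by \<open>norm h\<close>; it is the factor \<open>V\<close> or \<open>E\<close>
    next to it that makes each error term vanish.\<close>
  define L where "L h = Re (a * h) / norm h" for h
  have L_bd: "\<bar>L h\<bar> \<le> norm a" for h
    using Re_bd[of a h] by (cases "h = 0") (auto simp: L_def abs_divide divide_simps)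
  have U_VL: "U h = (V h + L h) * norm h" if "h \<noteq> 0" for h
    using that by (simp add: V_def L_def add_divide_distrib[symmetric])
  have BV: "\<forall>\<^sub>F h in at 0. \<bar>V h\<bar> < 1"
    using tendstoD[OF V0, of 1] by simp
  have U0: "(U \<longlongrightarrow> 0) (at 0)"
  proof (rule Lim_null_comparison)
    show "\<forall>\<^sub>F h in at 0. norm (U h) \<le> (1 + norm a) * norm h"
      using BV eventually_neq_at_within[of 0 0 UNIV]
    proof eventually_elim
      case (elim h)
      have "\<bar>V h + L h\<bar> \<le> 1 + norm a" using elim L_bd[of h] by linarith
      then show ?case using U_VL[OF elim(2)] by (simp add: abs_mult mult_right_mono)
    qed
    show "((\<lambda>h::complex. (1 + norm a) * norm h) \<longlongrightarrow> 0) (at 0)"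
      using tendsto_mult_left[OF n0, of "1 + norm a"] by simp
  qed
  have "(E \<longlongrightarrow> 0) (at 0)"
    using second_order_taylor[OF f f1]
    by (rule Lim_transform_eventually) (auto simp: E_def x_def eventually_at_filter)
  then have "isCont E 0" by (simp add: isCont_def E_def)
  then have EU: "((\<lambda>h. E (U h)) \<longlongrightarrow> 0) (at 0)"
    using isCont_tendsto_compose[OF _ U0] by (force simp: E_def)
  define b' where "b' = of_real (f1 x) * b + of_real (f2 / 4) * a\<^sup>2"
  define R where "R h = f1 x * e h + f2 / 2 * (V h * (V h + 2 * L h)) + E (U h) * (V h + L h)\<^sup>2" for h
  have bounded_mult: "((\<lambda>h. A h * B h) \<longlongrightarrow> 0) (at 0)"
    if "(A \<longlongrightarrow> 0) (at 0)" "\<forall>\<^sub>F h in at 0. \<bar>B h\<bar> \<le> K" for A B :: "complex \<Rightarrow> real" and K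
  proof (rule Lim_null_comparison)
    show "\<forall>\<^sub>F h in at 0. norm (A h * B h) \<le> \<bar>A h\<bar> * K"
      using that(2) by eventually_elim (simp add: abs_mult mult_left_mono)
    show "((\<lambda>h. \<bar>A h\<bar> * K) \<longlongrightarrow> 0) (at 0)"
      using tendsto_mult_right[OF tendsto_rabs_zero[OF that(1)], of K] by simp
  qed
  have "((\<lambda>h. V h * (V h + 2 * L h)) \<longlongrightarrow> 0) (at 0)"
  proof (rule bounded_mult[OF V0])
    show "\<forall>\<^sub>F h in at 0. \<bar>V h + 2 * L h\<bar> \<le> 1 + 2 * norm a"
      using BV
    proof eventually_elim
      case (elim h) then show ?case using L_bd[of h] by linarith
    qed
  qed
  moreover have "((\<lambda>h. E (U h) * (V h + L h)\<^sup>2) \<longlongrightarrow> 0) (at 0)"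
  proof (rule bounded_mult[OF EU])
    show "\<forall>\<^sub>F h in at 0. \<bar>(V h + L h)\<^sup>2\<bar> \<le> (1 + norm a)\<^sup>2"
      using BV
    proof eventually_elim
      case (elim h) then have "\<bar>V h + L h\<bar> \<le> 1 + norm a" using L_bd[of h] by linarith
      then show ?case by (simp add: abs_le_square_iff[symmetric])
    qed
  qed
  ultimately have "(R \<longlongrightarrow> f1 x * 0 + f2 / 2 * 0 + 0) (at 0)"
    unfolding R_def by (intro tendsto_intros e0)
  then have R0: "(R \<longlongrightarrow> 0) (at 0)" by simp
  have "(f (u (z + h)) - f (u z) - Re (of_real (f1 x) * a * h) - Re (b' * h\<^sup>2)
      - (f1 x * q + f2 * (norm a)\<^sup>2) / 4 * (norm h)\<^sup>2) / (norm h)\<^sup>2 = R h" if h: "h \<noteq> 0" for h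
  proof -
    have "f (x + U h) - f x - f1 x * U h - f2 / 2 * (U h)\<^sup>2 = E (U h) * (U h)\<^sup>2"
      by (simp add: E_def)
    then have fu: "f (u (z + h)) - f (u z) = f1 x * U h + f2 / 2 * (U h)\<^sup>2 + E (U h) * (U h)\<^sup>2"
      by (simp add: U_def x_def)
    have sq: "(Re (a * h))\<^sup>2 = (norm a)\<^sup>2 * (norm h)\<^sup>2 / 2 + Re (a\<^sup>2 * h\<^sup>2) / 2"
      unfolding cmod_power2 by (simp add: power2_eq_square) (simp add: field_simps)
    have Reb: "Re (b' * h\<^sup>2) = f1 x * Re (b * h\<^sup>2) + f2 / 4 * Re (a\<^sup>2 * h\<^sup>2)"
      by (simp add: b'_def field_simps)
    have Rea: "Re (of_real (f1 x) * a * h) = f1 x * Re (a * h)"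
      by (simp add: algebra_simps)
    have UU: "(U h)\<^sup>2 = (V h * (V h + 2 * L h)) * (norm h)\<^sup>2 + (Re (a * h))\<^sup>2"
      using h by (simp add: U_VL[OF h] L_def power2_eq_square field_simps)
    have lin: "f1 x * U h = f1 x * (Re (a * h) + Re (b * h\<^sup>2) + q / 4 * (norm h)\<^sup>2 + e h * (norm h)\<^sup>2)"
      using Ueq[OF h] by (simp only:)
    have "f (u (z + h)) - f (u z) - Re (of_real (f1 x) * a * h) - Re (b' * h\<^sup>2)
      - (f1 x * q + f2 * (norm a)\<^sup>2) / 4 * (norm h)\<^sup>2
      = f1 x * (e h * (norm h)\<^sup>2) + f2 / 2 * ((U h)\<^sup>2 - (Re (a * h))\<^sup>2) + E (U h) * (U h)\<^sup>2"
      unfolding fu Reb Rea sq lin by (simp del: times_complex.sel add: field_simps)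
    also have "\<dots> = f1 x * (e h * (norm h)\<^sup>2) + f2 / 2 * (V h * (V h + 2 * L h)) * (norm h)\<^sup>2
        + E (U h) * ((V h + L h)\<^sup>2 * (norm h)\<^sup>2)"
      using UU U_VL[OF h] by (simp add: power_mult_distrib)
    also have "\<dots> = R h * (norm h)\<^sup>2"
      by (simp add: R_def algebra_simps)
    finally show ?thesis using h by simp
  qed
  then have "((\<lambda>h. (f (u (z + h)) - f (u z) - Re (of_real (f1 x) * a * h) - Re (b' * h\<^sup>2)
      - (f1 x * q + f2 * (norm a)\<^sup>2) / 4 * (norm h)\<^sup>2) / (norm h)\<^sup>2) \<longlongrightarrow> 0) (at 0)"
    by (intro Lim_transform_eventually[OF R0]) (auto simp: eventually_at_filter)
  then show ?thesis
    unfolding has_jet_def x_def by blast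
qed

text \<open>
  Harmonicity of the logarithm, read off the chain rule for \<open>ln ((norm (z - p))\<^sup>2) / 2\<close>.
\<close>

lemma has_jet_ln_norm:
  assumes "z \<noteq> p"
  shows "has_jet (\<lambda>w. ln (norm (w - p))) z (1 / (z - p)) 0"
proof -
  define x where "x = (norm (z - p))\<^sup>2"
  have x: "x > 0" using assms by (simp add: x_def)
  have "has_jet (\<lambda>w. ln ((norm (w - p))\<^sup>2) / 2) z
      (of_real (1 / (2 * x)) * (2 * cnj (z - p)))
      (1 / (2 * x) * 4 + (- 1 / (2 * x\<^sup>2)) * (norm (2 * cnj (z - p)))\<^sup>2)"
    unfolding x_def
  proof (rule has_jet_compose[OF has_jet_norm_sq, where f = "\<lambda>t. ln t / 2" and ?f1.0 = "\<lambda>t. 1 / (2 * t)"], fold x_def)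
    have "\<forall>\<^sub>F t in nhds x. t \<in> {0<..}" using x by (intro eventually_nhds_in_open) auto
    then show "\<forall>\<^sub>F t in nhds x. ((\<lambda>t. ln t / 2) has_real_derivative 1 / (2 * t)) (at t)"
      by eventually_elim (auto intro!: derivative_eq_intros simp: field_simps)
    show "((\<lambda>t. 1 / (2 * t)) has_real_derivative - 1 / (2 * x\<^sup>2)) (at x)"
      using x by (auto intro!: derivative_eq_intros simp: field_simps power2_eq_square)
  qed
  moreover have "of_real (1 / (2 * x)) * (2 * cnj (z - p)) = 1 / (z - p)"
    using assms by (simp add: x_def complex_norm_square divide_simps del: complex_cnj_diff of_real_power)
  moreover have "1 / (2 * x) * 4 + (- 1 / (2 * x\<^sup>2)) * (norm (2 * cnj (z - p)))\<^sup>2 = 0"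
  proof -
    have "(norm (2 * cnj (z - p)))\<^sup>2 = 4 * x" by (simp add: x_def norm_mult power_mult_distrib del: complex_cnj_diff)
    then show ?thesis using x by (simp add: field_simps power2_eq_square)
  qed
  moreover have "ln ((norm (w - p))\<^sup>2) / 2 = ln (norm (w - p))" for w
    by (cases "w = p") (simp_all add: ln_realpow)
  ultimately show ?thesis by simp
qed

lemma Re_cis_has_integral_0:
  assumes "k = 1 \<or> k = 2"
  shows "((\<lambda>t. Re (c * cis (k * t))) has_integral 0) {0..2 * pi}"
proof -
  have k: "k \<noteq> 0" using assms by auto
  have "((\<lambda>t. Re (c * cis (k * t))) has_integral
      (Re c * sin (k * (2 * pi)) + Im c * cos (k * (2 * pi))) / k
      - (Re c * sin (k * 0) + Im c * cos (k * 0)) / k) {0..2 * pi}"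
  proof (rule fundamental_theorem_of_calculus)
    fix t
    show "((\<lambda>t. (Re c * sin (k * t) + Im c * cos (k * t)) / k) has_vector_derivative Re (c * cis (k * t)))
        (at t within {0..2 * pi})"
      unfolding has_real_derivative_iff_has_vector_derivative[symmetric]
      using k by (auto intro!: derivative_eq_intros simp: field_simps)
  qed simp
  moreover have "cos (k * (2 * pi)) = 1 \<and> sin (k * (2 * pi)) = 0"
    using assms cos_two_pi sin_two_pi cos_double[of "2 * pi"] sin_double[of "2 * pi"]
    by (auto simp: algebra_simps)
  ultimately show ?thesis by simp
qed

text \<open>
  The expression whose lower limit at \<open>r = 0\<close> is the generalized Laplacian.
\<close>

definition circle_quotient :: "(complex \<Rightarrow> real) \<Rightarrow> complex \<Rightarrow> real \<Rightarrow> real" where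
  "circle_quotient u z r =
     4 / r\<^sup>2 * (1 / (2 * pi) * integral {0..2 * pi} (\<lambda>t. u (z + of_real r * cis t)) - u z)"

lemma circle_integrable:
  fixes u :: "complex \<Rightarrow> real"
  assumes "continuous_on (cball z R) u" "0 \<le> r" "r \<le> R"
  shows "(\<lambda>t. u (z + of_real r * cis t)) integrable_on {0..2 * pi}"
proof -
  have "continuous_on {0..2 * pi} (\<lambda>t. z + of_real r * cis t)"
    by (intro continuous_intros)
  moreover have "(\<lambda>t. z + of_real r * cis t) ` {0..2 * pi} \<subseteq> cball z R"
    using assms by (auto simp: dist_norm norm_mult)
  ultimately have "continuous_on {0..2 * pi} (\<lambda>t. u (z + of_real r * cis t))"
    using continuous_on_compose2[OF assms(1)] by blast
  then show ?thesis by (rule integrable_continuous_real)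
qed

text \<open>
  Over a circle the linear and the harmonic quadratic part of the expansion integrate to zero, and
  \<open>q / 4 * r\<^sup>2\<close> is constant; the factor \<open>4 / r\<^sup>2\<close> then leaves \<open>q\<close> and an error that is controlled by
  the remainder.
\<close>

lemma has_jet_circle_quotient:
  assumes u: "has_jet u z a q" and R: "R > 0" and cont: "continuous_on (cball z R) u"
  shows "(circle_quotient u z \<longlongrightarrow> q) (at_right 0)"
proof (rule tendstoI)
  fix \<epsilon> :: real assume \<epsilon>: "\<epsilon> > 0"
  obtain b where b:
    "((\<lambda>h. (u (z + h) - u z - Re (a * h) - Re (b * h\<^sup>2) - q / 4 * (norm h)\<^sup>2) / (norm h)\<^sup>2) \<longlongrightarrow> 0) (at 0)"
    using u unfolding has_jet_def by blast
  from tendstoD[OF b, of "\<epsilon> / 8"] \<epsilon> obtain d where d: "d > 0" "\<And>h. h \<noteq> 0 \<Longrightarrow> norm h < d \<Longrightarrow>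
    \<bar>(u (z + h) - u z - Re (a * h) - Re (b * h\<^sup>2) - q / 4 * (norm h)\<^sup>2) / (norm h)\<^sup>2\<bar> < \<epsilon> / 8"
    unfolding eventually_at by (auto simp: dist_norm)
  have "\<forall>\<^sub>F r in at_right 0. r \<in> {0<..<min d R}"
    using d R by (intro eventually_at_right_real) auto
  then show "\<forall>\<^sub>F r in at_right 0. dist (circle_quotient u z r) q < \<epsilon>"
  proof eventually_elim
    case (elim r)
    then have r: "0 < r" "r < d" "r < R" by auto
    define P where "P t = u z + q / 4 * r\<^sup>2 + Re ((a * of_real r) * cis (1 * t))
        + Re ((b * of_real (r\<^sup>2)) * cis (2 * t))" for t
    define W where "W t = u (z + of_real r * cis t)" for t
    have P: "(P has_integral (2 * pi * (u z + q / 4 * r\<^sup>2))) {0..2 * pi}"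
    proof -
      have "((\<lambda>t. u z + q / 4 * r\<^sup>2) has_integral (2 * pi * (u z + q / 4 * r\<^sup>2))) {0..2 * pi}"
        using has_integral_const_real[of "u z + q / 4 * r\<^sup>2" 0 "2 * pi"] by simp
      from has_integral_add[OF has_integral_add[OF this
          Re_cis_has_integral_0[of 1 "a * of_real r"]] Re_cis_has_integral_0[of 2 "b * of_real (r\<^sup>2)"]]
      show ?thesis unfolding P_def by (simp only: simp_thms add_0_right)
    qed
    have W: "(W has_integral integral {0..2 * pi} W) {0..2 * pi}"
      unfolding W_def using circle_integrable[OF cont, of r] r by (intro integrable_integral) auto
    have diff: "norm (W t - P t) \<le> \<epsilon> / 8 * r\<^sup>2" for t
    proof -
      let ?h = "of_real r * cis t"
      have nh: "norm ?h = r" using r by (simp add: norm_mult)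
      have "?h \<noteq> 0" using r by simp
      from d(2)[OF this] nh r
      have "\<bar>(u (z + ?h) - u z - Re (a * ?h) - Re (b * ?h\<^sup>2) - q / 4 * r\<^sup>2) / r\<^sup>2\<bar> < \<epsilon> / 8"
        by simp
      moreover have "u (z + ?h) - u z - Re (a * ?h) - Re (b * ?h\<^sup>2) - q / 4 * r\<^sup>2 = W t - P t"
      proof -
        have h2: "?h\<^sup>2 = of_real (r\<^sup>2) * cis (2 * t)"
          by (simp add: power_mult_distrib Complex.DeMoivre)
        show ?thesis unfolding W_def P_def h2 by (simp add: mult.assoc)
      qed
      ultimately have "\<bar>(W t - P t) / r\<^sup>2\<bar> < \<epsilon> / 8" by (simp only:)
      then show ?thesis using r by (simp add: abs_divide pos_divide_less_eq)
    qed
    have "norm (integral {0..2 * pi} W - 2 * pi * (u z + q / 4 * r\<^sup>2))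
        \<le> \<epsilon> / 8 * r\<^sup>2 * Henstock_Kurzweil_Integration.content {0..2 * pi}"
      by (rule has_integral_bound_real[OF _ _ has_integral_diff[OF W P], of _ "{}"]) (use diff \<epsilon> in auto)
    then have "\<bar>integral {0..2 * pi} W - 2 * pi * (u z + q / 4 * r\<^sup>2)\<bar> \<le> \<epsilon> / 8 * r\<^sup>2 * (2 * pi)"
      by simp
    moreover have "circle_quotient u z r - q
        = (integral {0..2 * pi} W - 2 * pi * (u z + q / 4 * r\<^sup>2)) * (4 / (r\<^sup>2 * (2 * pi)))"
      using r by (simp add: circle_quotient_def W_def[abs_def] field_simps)
    ultimately have "\<bar>circle_quotient u z r - q\<bar> \<le> \<epsilon> / 8 * r\<^sup>2 * (2 * pi) * (4 / (r\<^sup>2 * (2 * pi)))"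
      using r \<epsilon> by (simp only: abs_mult) (intro mult_mono, auto)
    also have "\<dots> = \<epsilon> / 2" using r by (simp add: field_simps)
    finally show ?case using \<epsilon> by (simp add: dist_real_def)
  qed
qed

lemma circle_quotient_mono:
  assumes "continuous_on (cball z R) u" "continuous_on (cball z R) v"
    and "\<And>w. w \<in> cball z R \<Longrightarrow> u w - u z \<le> v w - v z" and "0 < r" "r \<le> R"
  shows "circle_quotient u z r \<le> circle_quotient v z r"
proof -
  have "integral {0..2 * pi} (\<lambda>t. u (z + of_real r * cis t))
      \<le> integral {0..2 * pi} (\<lambda>t. v (z + of_real r * cis t) + (u z - v z))"
  proof (rule integral_le)
    show "(\<lambda>t. v (z + of_real r * cis t) + (u z - v z)) integrable_on {0..2 * pi}"
      using assms by (intro integrable_add circle_integrable[of z R] integrable_const_ivl) auto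
    fix t :: real
    have "z + of_real r * cis t \<in> cball z R" using assms by (simp add: dist_norm norm_mult)
    from assms(3)[OF this]
    show "u (z + of_real r * cis t) \<le> v (z + of_real r * cis t) + (u z - v z)" by simp
  qed (use assms in \<open>auto intro!: circle_integrable[of z R]\<close>)
  also have "\<dots> = integral {0..2 * pi} (\<lambda>t. v (z + of_real r * cis t)) + 2 * pi * (u z - v z)"
    using assms circle_integrable[OF assms(2), of r]
    by (subst integral_add) (auto simp: integrable_const_ivl)
  finally have "integral {0..2 * pi} (\<lambda>t. u (z + of_real r * cis t)) / (2 * pi)
      \<le> (integral {0..2 * pi} (\<lambda>t. v (z + of_real r * cis t)) + 2 * pi * (u z - v z)) / (2 * pi)"
    by (intro divide_right_mono) auto
  then have "1 / (2 * pi) * integral {0..2 * pi} (\<lambda>t. u (z + of_real r * cis t)) - u z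
      \<le> 1 / (2 * pi) * integral {0..2 * pi} (\<lambda>t. v (z + of_real r * cis t)) - v z"
    by (simp add: add_divide_distrib)
  then show ?thesis
    unfolding circle_quotient_def by (intro mult_left_mono) auto
qed

lemma gen_laplacian_circle_quotient:
  "gen_laplacian u z = Liminf (at_right 0) (\<lambda>r. ereal (circle_quotient u z r))"
  by (simp add: gen_laplacian_def circle_quotient_def)

text \<open>
  Comparison with a function that touches \<open>u\<close> from below at \<open>z\<close>. This is how Laplacians of
  maxima are estimated although a maximum need not have a jet.
\<close>

lemma gen_laplacian_ge_jet:
  assumes "has_jet v z a q" "R > 0"
    and "continuous_on (cball z R) u" "continuous_on (cball z R) v"
    and "\<And>w. w \<in> cball z R \<Longrightarrow> v w \<le> u w" "v z = u z"
  shows "ereal q \<le> gen_laplacian u z"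
proof -
  have "((\<lambda>r. ereal (circle_quotient v z r)) \<longlongrightarrow> ereal q) (at_right 0)"
    using has_jet_circle_quotient[OF assms(1,2,4)] by simp
  then have "ereal q = Liminf (at_right 0) (\<lambda>r. ereal (circle_quotient v z r))"
    by (intro lim_imp_Liminf[symmetric]) auto
  also have "\<dots> \<le> gen_laplacian u z"
    unfolding gen_laplacian_circle_quotient
  proof (rule Liminf_mono)
    have "\<forall>\<^sub>F r in at_right 0. r \<in> {0<..<R}"
      using assms(2) by (intro eventually_at_right_real)
    then show "\<forall>\<^sub>F r in at_right 0. ereal (circle_quotient v z r) \<le> ereal (circle_quotient u z r)"
      by eventually_elim (use assms in \<open>auto intro!: circle_quotient_mono[of z R]\<close>)
  qed
  finally show ?thesis .
qed

text \<open>
  The maximum principle: \<open>u - v\<close> has a local maximum at \<open>z\<close>.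
\<close>

lemma gen_laplacian_le_jet:
  assumes "has_jet v z a q" "R > 0"
    and "continuous_on (cball z R) u" "continuous_on (cball z R) v"
    and "\<And>w. w \<in> cball z R \<Longrightarrow> u w - u z \<le> v w - v z"
  shows "gen_laplacian u z \<le> ereal q"
proof -
  have "gen_laplacian u z \<le> Liminf (at_right 0) (\<lambda>r. ereal (circle_quotient v z r))"
    unfolding gen_laplacian_circle_quotient
  proof (rule Liminf_mono)
    have "\<forall>\<^sub>F r in at_right 0. r \<in> {0<..<R}"
      using assms(2) by (intro eventually_at_right_real)
    then show "\<forall>\<^sub>F r in at_right 0. ereal (circle_quotient u z r) \<le> ereal (circle_quotient v z r)"
      by eventually_elim (use assms in \<open>auto intro!: circle_quotient_mono[of z R]\<close>)
  qed
  also have "\<dots> = ereal q"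
    using has_jet_circle_quotient[OF assms(1,2,4)]
    by (intro lim_imp_Liminf) auto
  finally show ?thesis .
qed

lemma curvature_le_minus_one_iff:
  assumes "\<rho> z > 0"
  shows "curvature \<rho> z \<le> -1 \<longleftrightarrow> ereal ((\<rho> z)\<^sup>2) \<le> gen_laplacian (\<lambda>w. ln (\<rho> w)) z"
proof -
  have pos: "(\<rho> z)\<^sup>2 > 0" using assms by simp
  have m1: "(-1 :: ereal) = ereal (-1)" by (simp add: one_ereal_def)
  show ?thesis
    unfolding curvature_def m1
    using pos by (cases "gen_laplacian (\<lambda>w. ln (\<rho> w)) z") (simp_all add: divide_simps)
qed

section \<open>An SK-metric on the twice punctured plane\<close>

text \<open>
  Touching densities \<open>v\<close> with \<open>\<Delta>(ln v) \<ge> v\<^sup>2\<close> at the point of contact suffice, which is the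
  criterion that a maximum of two SK-densities satisfies.
\<close>

lemma sk_metricI_jet:
  assumes G: "open G" "G \<noteq> {}" and cont: "continuous_on G \<rho>" and pos: "\<And>z. z \<in> G \<Longrightarrow> \<rho> z > 0"
    and jet: "\<And>z. z \<in> G \<Longrightarrow> \<exists>v a q. has_jet (\<lambda>w. ln (v w)) z a q \<and> (\<rho> z)\<^sup>2 \<le> q \<and>
      continuous_on G v \<and> (\<forall>w\<in>G. 0 < v w \<and> v w \<le> \<rho> w) \<and> v z = \<rho> z"
  shows "sk_metric G \<rho>"
  unfolding sk_metric_def conformal_pseudo_metric_def
proof (intro conjI ballI impI)
  show "continuous_on G \<rho>" by fact
  show "\<exists>z\<in>G. \<rho> z \<noteq> 0" using G pos by force
next
  fix z assume z: "z \<in> G"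
  show "0 \<le> \<rho> z" using pos[OF z] by simp
  obtain v a q where v: "has_jet (\<lambda>w. ln (v w)) z a q" "(\<rho> z)\<^sup>2 \<le> q" "continuous_on G v"
    "\<And>w. w \<in> G \<Longrightarrow> 0 < v w" "\<And>w. w \<in> G \<Longrightarrow> v w \<le> \<rho> w" "v z = \<rho> z"
    using jet[OF z] by blast
  obtain R where R: "R > 0" "cball z R \<subseteq> G"
    using G(1) z by (meson open_contains_cball)
  have "ereal ((\<rho> z)\<^sup>2) \<le> ereal q" using v(2) by simp
  also have "\<dots> \<le> gen_laplacian (\<lambda>w. ln (\<rho> w)) z"
  proof (rule gen_laplacian_ge_jet[OF v(1) R(1)])
    show "continuous_on (cball z R) (\<lambda>w. ln (\<rho> w))"
      using R pos by (intro continuous_on_ln continuous_on_subset[OF cont]) force+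
    show "continuous_on (cball z R) (\<lambda>w. ln (v w))"
      using R v(4) by (intro continuous_on_ln continuous_on_subset[OF v(3)]) force+
    show "ln (v w) \<le> ln (\<rho> w)" if "w \<in> cball z R" for w
      using that R v(4,5) by (meson ln_mono order.strict_trans2 subsetD)
    show "ln (v z) = ln (\<rho> z)" using v(6) by simp
  qed
  finally show "curvature \<rho> z \<le> -1"
    using curvature_le_minus_one_iff pos[OF z] by blast
qed

text \<open>
  The logarithm of \<open>exp k * sqrt (1 + r powr (2/5)) * r powr (-4/5)\<close> as a function of \<open>s = ln r\<close>.
  The exponents make the product of two such factors an SK-density: with \<open>A = r powr (2/5)\<close>
  the Laplacian of its logarithm is \<open>2 / 25 / (A ^ 4 * (1 + A)\<^sup>2)\<close> and the square of the factor is
  \<open>exp (2 * k) * (1 + A) / A ^ 4\<close>, so these have the same order at the puncture, and \<open>2/5\<close> is the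
  largest exponent for which the comparison also survives at infinity.
\<close>

definition puncture_term :: "real \<Rightarrow> real \<Rightarrow> real" where
  "puncture_term k s = k + ln (1 + exp (2 / 5 * s)) / 2 - 4 / 5 * s"

lemma has_jet_puncture_term:
  assumes "z \<noteq> p"
  defines "A \<equiv> exp (2 / 5 * ln (norm (z - p)))"
  shows "\<exists>a. has_jet (\<lambda>w. puncture_term k (ln (norm (w - p)))) z a (2 / 25 / (A ^ 4 * (1 + A)\<^sup>2))"
proof -
  define s where "s = ln (norm (z - p))"
  define f1 where "f1 = (\<lambda>t::real. 1 / 5 * (exp (2 / 5 * t) / (1 + exp (2 / 5 * t))) - 4 / 5)"
  have npos: "1 + exp (2 / 5 * t) \<noteq> 0" "1 + exp (2 / 5 * t) > 0" for t :: real
    using exp_gt_zero[of "2 / 5 * t"] by linarith+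
  have "has_jet (\<lambda>w. puncture_term k (ln (norm (w - p)))) z (of_real (f1 s) * (1 / (z - p)))
     (f1 s * 0 + 2 / 25 * (A / (1 + A)\<^sup>2) * (norm (1 / (z - p)))\<^sup>2)"
    unfolding s_def
  proof (rule has_jet_compose[OF has_jet_ln_norm[OF assms(1)]], fold s_def)
    show "\<forall>\<^sub>F y in nhds s. (puncture_term k has_real_derivative f1 y) (at y)"
    proof (rule always_eventually, rule allI)
      fix y :: real
      define E where "E = exp (2 / 5 * y)"
      have "((\<lambda>t. ln (1 + exp (2 / 5 * t))) has_real_derivative (E * (2 / 5) / (1 + E))) (at y)"
        unfolding E_def using npos[of y] by (auto intro!: derivative_eq_intros)
      then have "((\<lambda>t. k + ln (1 + exp (2 / 5 * t)) / 2 - 4 / 5 * t) has_real_derivative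
          (0 + E * (2 / 5) / (1 + E) / 2 - 4 / 5)) (at y)"
        by (intro DERIV_diff DERIV_add DERIV_const DERIV_cdivide DERIV_cmult_Id)
      then have "(puncture_term k has_real_derivative (E * (2 / 5) / (1 + E) / 2 - 4 / 5)) (at y)"
        by (simp only: puncture_term_def[abs_def] add_0)
      moreover have "E * (2 / 5) / D / 2 - 4 / 5 = 1 / 5 * (E / D) - 4 / 5" for D
        by simp
      from this[of "1 + E"] have "E * (2 / 5) / (1 + E) / 2 - 4 / 5 = f1 y"
        unfolding f1_def E_def .
      ultimately show "(puncture_term k has_real_derivative f1 y) (at y)" by (rule DERIV_cong)
    qed
    have "(f1 has_real_derivative (1 / 5 * ((2 / 5 * A * (1 + A) - A * (2 / 5 * A)) / ((1 + A) * (1 + A))))) (at s)"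
    proof -
      have A: "A = exp (2 / 5 * s)" by (simp add: A_def s_def)
      have e: "((\<lambda>t. exp (2 / 5 * t)) has_real_derivative 2 / 5 * A) (at s)"
        "((\<lambda>t. 1 + exp (2 / 5 * t)) has_real_derivative 2 / 5 * A) (at s)"
        unfolding A by (auto intro!: derivative_eq_intros)
      from DERIV_diff[OF DERIV_cmult[OF DERIV_divide[OF e npos(1)[of s]], of "1 / 5"] DERIV_const[of "4 / 5"]]
      show ?thesis unfolding f1_def A[symmetric] by (simp only: diff_0_right)
    qed
    moreover have "1 / 5 * ((2 / 5 * A * (1 + A) - A * (2 / 5 * A)) / ((1 + A) * (1 + A))) = 2 / 25 * (A / (1 + A)\<^sup>2)"
    proof -
      have "2 / 5 * A * (1 + A) - A * (2 / 5 * A) = 2 / 5 * A" by (simp add: field_simps)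
      show ?thesis unfolding \<open>2 / 5 * A * (1 + A) - A * (2 / 5 * A) = 2 / 5 * A\<close>
        by (simp add: power2_eq_square)
    qed
    ultimately show "(f1 has_real_derivative (2 / 25 * (A / (1 + A)\<^sup>2))) (at s)" by simp
  qed
  moreover have "(norm (1 / (z - p)))\<^sup>2 = 1 / A ^ 5"
  proof -
    have "A ^ 5 = exp (2 * ln (norm (z - p)))"
      unfolding A_def exp_of_nat_mult[symmetric] by simp
    also have "\<dots> = (norm (z - p))\<^sup>2"
      using assms(1) by (simp add: exp_double)
    finally show ?thesis by (simp add: norm_divide power_divide)
  qed
  moreover have "f1 s * 0 + 2 / 25 * (A / (1 + A)\<^sup>2) * (1 / A ^ 5) = 2 / 25 / (A ^ 4 * (1 + A)\<^sup>2)"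
  proof -
    have "A > 0" by (simp add: A_def)
    then show ?thesis by (simp add: field_simps eval_nat_numeral)
  qed
  ultimately show ?thesis by metis
qed

text \<open>
  The curvature condition for the product density, where \<open>A\<close> and \<open>B\<close> are the powers \<open>2/5\<close> of the
  distances to the two punctures. The larger one, \<open>b\<close>, is bounded below, so
  \<open>(1 + a) ^ 3 * (1 + b) \<le> (1 + b) ^ 4\<close> is at most a constant times \<open>b ^ 4\<close>; the summand of the smaller
  one alone then dominates the left-hand side.
\<close>

lemma puncture_inequality:
  fixes A B K m :: real
  assumes "0 < A" "0 < B" "0 < m" "m \<le> max A B" "0 \<le> K" "K * (1 + 1 / m) ^ 4 \<le> 2 / 25"
  shows "K * ((1 + A) * (1 + B)) / (A ^ 4 * B ^ 4)
    \<le> 2 / 25 / (A ^ 4 * (1 + A)\<^sup>2) + 2 / 25 / (B ^ 4 * (1 + B)\<^sup>2)"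
proof -
  have main: "K * ((1 + a) * (1 + b)) / (a ^ 4 * b ^ 4) \<le> 2 / 25 / (a ^ 4 * (1 + a)\<^sup>2)"
    if "0 < a" "a \<le> b" "m \<le> b" for a b
  proof -
    have b: "b > 0" using that by linarith
    have "1 + b \<le> (1 + 1 / m) * b"
      using assms(3) that by (simp add: field_simps)
    then have B4: "(1 + b) ^ 4 \<le> ((1 + 1 / m) * b) ^ 4"
      using b by (intro power_mono) auto
    have "K * ((1 + a) ^ 3 * (1 + b)) \<le> K * ((1 + b) ^ 3 * (1 + b))"
      using that assms by (intro mult_left_mono mult_right_mono power_mono) auto
    also have "\<dots> = K * (1 + b) ^ 4" by (simp add: eval_nat_numeral)
    also have "\<dots> \<le> K * ((1 + 1 / m) * b) ^ 4" using B4 assms(5) by (rule mult_left_mono)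
    also have "\<dots> = K * (1 + 1 / m) ^ 4 * b ^ 4" by (simp only: power_mult_distrib mult.assoc)
    also have "\<dots> \<le> 2 / 25 * b ^ 4" using assms(6) b by (intro mult_right_mono) auto
    finally have *: "K * ((1 + a) ^ 3 * (1 + b)) \<le> 2 / 25 * b ^ 4" .
    have "K * ((1 + a) * (1 + b)) / (a ^ 4 * b ^ 4)
        = K * ((1 + a) ^ 3 * (1 + b)) / (a ^ 4 * b ^ 4 * (1 + a)\<^sup>2)"
      using that(1) b by (simp add: divide_simps) (simp add: eval_nat_numeral)
    also have "\<dots> \<le> 2 / 25 * b ^ 4 / (a ^ 4 * b ^ 4 * (1 + a)\<^sup>2)"
      using * that(1) b by (intro divide_right_mono) auto
    also have "\<dots> = 2 / 25 / (a ^ 4 * (1 + a)\<^sup>2)"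
      using b by (simp add: divide_simps)
    finally show ?thesis .
  qed
  have nn: "0 \<le> 2 / 25 / (A ^ 4 * (1 + A)\<^sup>2)" "0 \<le> 2 / 25 / (B ^ 4 * (1 + B)\<^sup>2)"
    by simp_all
  show ?thesis
  proof (cases "A \<le> B")
    case True
    then have "m \<le> B" using assms(4) by simp
    from main[OF assms(1) True this] nn show ?thesis by linarith
  next
    case False
    then have "B \<le> A" "m \<le> A" using assms(4) by simp_all
    from main[OF assms(2) this] nn show ?thesis
      unfolding mult.commute[of "1 + B" "1 + A"] mult.commute[of "B ^ 4" "A ^ 4"] by linarith
  qed
qed

text \<open>
  For \<open>norm (z - p) < 1\<close> this is the density \<open>1 / (r * ln (\<rho> / r))\<close> of the punctured disc of radius
  \<open>\<rho> = exp C\<close>; for \<open>norm (z - p) > 1\<close> it is the image of that metric under inversion.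
\<close>

definition punctured_disc_density :: "real \<Rightarrow> complex \<Rightarrow> complex \<Rightarrow> real" where
  "punctured_disc_density C p z = 1 / (norm (z - p) * (C + \<bar>ln (norm (z - p))\<bar>))"

lemma punctured_disc_density_pos:
  assumes "z \<noteq> p" "C > 0"
  shows "punctured_disc_density C p z > 0"
  using assms by (simp add: punctured_disc_density_def add_pos_nonneg)

text \<open>
  Off the unit circle the curvature is exactly \<open>-1\<close>. On the circle the absolute value puts a
  concave kink into the logarithm of the density, hence the last hypothesis.
\<close>

lemma has_jet_punctured_disc_density:
  assumes "z \<noteq> p" "C > 0" "norm (z - p) \<noteq> 1"
  shows "\<exists>a. has_jet (\<lambda>w. ln (punctured_disc_density C p w)) z a ((punctured_disc_density C p z)\<^sup>2)"
proof -
  define x where "x = ln (norm (z - p))"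
  define c where "c = sgn x"
  have x: "x \<noteq> 0" using assms unfolding x_def by (subst ln_eq_zero_iff) auto
  have c: "c * c = 1" "c * x = \<bar>x\<bar>" using x by (auto simp: c_def sgn_if)
  define S where "S = {y. 0 < c * y}"
  have S: "open S" "x \<in> S"
    unfolding S_def using x c by (auto intro!: open_Collect_less continuous_intros)
  have S_abs: "\<bar>y\<bar> = c * y" if "y \<in> S" for y
    using that x by (auto simp: S_def c_def sgn_if split: if_splits)
  have "has_jet (\<lambda>w. - ln (norm (w - p)) - ln (C + \<bar>ln (norm (w - p))\<bar>)) z
      (of_real (- 1 - c / (C + c * x)) * (1 / (z - p)))
      ((- 1 - c / (C + c * x)) * 0 + 1 / (C + \<bar>x\<bar>)\<^sup>2 * (norm (1 / (z - p)))\<^sup>2)"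
    unfolding x_def
  proof (rule has_jet_compose[OF has_jet_ln_norm[OF assms(1)], where f = "\<lambda>y. - y - ln (C + \<bar>y\<bar>)"
        and ?f1.0 = "\<lambda>y. - 1 - c / (C + c * y)"], fold x_def)
    have "\<forall>\<^sub>F y in nhds x. y \<in> S" using S by (rule eventually_nhds_in_open)
    then show "\<forall>\<^sub>F y in nhds x. ((\<lambda>y. - y - ln (C + \<bar>y\<bar>)) has_real_derivative - 1 - c / (C + c * y)) (at y)"
    proof eventually_elim
      case (elim y)
      have "C + c * y > 0" using elim assms(2) by (simp add: S_def)
      then have "((\<lambda>y. - y - ln (C + c * y)) has_real_derivative - 1 - c / (C + c * y)) (at y)"
        by (auto intro!: derivative_eq_intros)
      then show ?case
        using S(1) elim by (rule has_field_derivative_transform_within_open) (simp add: S_abs)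
    qed
    have "C + c * x > 0" using S(2) assms(2) by (simp add: S_def)
    then have "((\<lambda>y. - 1 - c / (C + c * y)) has_real_derivative c * c / ((C + c * x) * (C + c * x))) (at x)"
      by (auto intro!: derivative_eq_intros simp: field_simps)
    then show "((\<lambda>y. - 1 - c / (C + c * y)) has_real_derivative 1 / (C + \<bar>x\<bar>)\<^sup>2) (at x)"
      using c by (simp add: power2_eq_square)
  qed
  moreover have "\<forall>\<^sub>F w in nhds z. - ln (norm (w - p)) - ln (C + \<bar>ln (norm (w - p))\<bar>)
      = ln (punctured_disc_density C p w)"
  proof -
    have "\<forall>\<^sub>F w in nhds z. w \<in> - {p}"
      using assms(1) by (intro eventually_nhds_in_open) auto
    then show ?thesis
    proof eventually_elim
      case (elim w)
      moreover have "C + \<bar>ln (norm (w - p))\<bar> > 0" using assms(2) by (simp add: add_pos_nonneg)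
      ultimately show ?case by (simp add: punctured_disc_density_def ln_div ln_mult)
    qed
  qed
  ultimately have "has_jet (\<lambda>w. ln (punctured_disc_density C p w)) z
      (of_real (- 1 - c / (C + c * x)) * (1 / (z - p)))
      ((- 1 - c / (C + c * x)) * 0 + 1 / (C + \<bar>x\<bar>)\<^sup>2 * (norm (1 / (z - p)))\<^sup>2)"
    by (rule has_jet_cong[rotated])
  moreover have "(- 1 - c / (C + c * x)) * 0 + 1 / (C + \<bar>x\<bar>)\<^sup>2 * (norm (1 / (z - p)))\<^sup>2
      = (punctured_disc_density C p z)\<^sup>2"
    by (simp add: punctured_disc_density_def x_def norm_divide power_divide power_mult_distrib mult.commute)
  ultimately show ?thesis by metis
qed

text \<open>
  The maximum of the product density \<open>\<sigma>\<close> and of the punctured disc density \<open>\<tau>\<close>. The constant \<open>C\<close> is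
  so large that \<open>\<sigma>\<close> wins on the unit circle about \<open>p\<close>, the only place where \<open>\<tau>\<close> fails to be SK.
\<close>

lemma exists_sk_metric_twice_punctured:
  assumes "p \<noteq> q"
  obtains C \<mu> where "C > 0"
    "\<And>z. z \<noteq> p \<Longrightarrow> z \<noteq> q \<Longrightarrow> punctured_disc_density C p z \<le> \<mu> z"
    "\<And>G. open G \<Longrightarrow> G \<noteq> {} \<Longrightarrow> p \<notin> G \<Longrightarrow> q \<notin> G \<Longrightarrow> sk_metric G \<mu>"
proof -
  define D where "D = norm (p - q)"
  have D: "D > 0" using assms by (simp add: D_def)
  define m where "m = exp (2 / 5 * ln (D / 2))"
  have m: "m > 0" by (simp add: m_def)
  \<comment> \<open>One of the distances to \<open>p\<close> and \<open>q\<close> is at least \<open>D / 2\<close>, so \<open>m\<close> bounds the larger of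
    their \<open>2/5\<close>-th powers from below. \<open>K\<close> is the squared scale of the density.\<close>
  define K where "K = 2 / 25 / (1 + 1 / m) ^ 4"
  have K: "K > 0" "K * (1 + 1 / m) ^ 4 \<le> 2 / 25"
    using add_pos_pos[of 1 "1 / m"] m by (simp_all add: K_def)
  define k where "k = ln K / 4"
  define \<sigma> where "\<sigma> z = exp (puncture_term k (ln (norm (z - p))) + puncture_term k (ln (norm (z - q))))" for z
  \<comment> \<open>\<open>L\<close> is a lower bound of \<open>\<sigma>\<close> on the unit circle about \<open>p\<close>, where the distance to \<open>q\<close> is at most
    \<open>1 + D\<close> and \<open>\<tau>\<close> has the constant value \<open>1 / C\<close>.\<close>
  define L where "L = exp (2 * k - 4 / 5 * ln (1 + D))"
  define C where "C = 1 + 1 / L"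
  have L: "L > 0" by (simp add: L_def)
  have C: "C > 0" using L by (simp add: C_def add_pos_pos)
  define \<tau> where "\<tau> = punctured_disc_density C p"
  define \<mu> where "\<mu> z = max (\<sigma> z) (\<tau> z)" for z
  have jet_\<sigma>: "\<exists>a q'. has_jet (\<lambda>w. ln (\<sigma> w)) z a q' \<and> (\<sigma> z)\<^sup>2 \<le> q'" if z: "z \<noteq> p" "z \<noteq> q" for z
  proof -
    define A where "A = exp (2 / 5 * ln (norm (z - p)))"
    define B where "B = exp (2 / 5 * ln (norm (z - q)))"
    obtain a b where
      "has_jet (\<lambda>w. puncture_term k (ln (norm (w - p)))) z a (2 / 25 / (A ^ 4 * (1 + A)\<^sup>2))"
      "has_jet (\<lambda>w. puncture_term k (ln (norm (w - q)))) z b (2 / 25 / (B ^ 4 * (1 + B)\<^sup>2))"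
      using has_jet_puncture_term z unfolding A_def B_def by blast
    note jet = has_jet_add[OF this]
    have "D \<le> norm (z - p) + norm (z - q)"
      unfolding D_def using norm_triangle_ineq4[of "z - q" "z - p"] by simp
    then have "D / 2 \<le> norm (z - p) \<or> D / 2 \<le> norm (z - q)" by linarith
    then have "m \<le> A \<or> m \<le> B"
      unfolding m_def A_def B_def using D z by (auto simp: ln_mono)
    then have mAB: "m \<le> max A B" by auto
    have sq: "(exp (puncture_term k s))\<^sup>2 = exp (2 * k) * (1 + exp (2 / 5 * s)) / exp (2 / 5 * s) ^ 4" for s
    proof -
      have "1 + exp (2 / 5 * s) > 0" using exp_gt_zero[of "2 / 5 * s"] by linarith
      then have e: "exp (ln (1 + exp (2 / 5 * s))) = 1 + exp (2 / 5 * s)" by simp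
      have "(exp (puncture_term k s))\<^sup>2 = exp (2 * puncture_term k s)"
        by (simp add: exp_double)
      also have "2 * puncture_term k s = 2 * k + ln (1 + exp (2 / 5 * s)) - of_nat 4 * (2 / 5 * s)"
        by (simp add: puncture_term_def)
      also have "exp \<dots> = exp (2 * k) * (1 + exp (2 / 5 * s)) / exp (2 / 5 * s) ^ 4"
        unfolding exp_diff exp_add exp_of_nat_mult e ..
      finally show ?thesis .
    qed
    have "exp (2 * k) * exp (2 * k) = K"
      using K(1) by (simp add: k_def exp_add[symmetric])
    then have "(\<sigma> z)\<^sup>2 = K * ((1 + A) * (1 + B)) / (A ^ 4 * B ^ 4)"
      unfolding \<sigma>_def exp_add power_mult_distrib sq A_def B_def by (simp add: ac_simps)
    also have "\<dots> \<le> 2 / 25 / (A ^ 4 * (1 + A)\<^sup>2) + 2 / 25 / (B ^ 4 * (1 + B)\<^sup>2)"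
      using mAB K m by (intro puncture_inequality[of A B m]) (auto simp: A_def B_def)
    finally have "(\<sigma> z)\<^sup>2 \<le> 2 / 25 / (A ^ 4 * (1 + A)\<^sup>2) + 2 / 25 / (B ^ 4 * (1 + B)\<^sup>2)" .
    moreover have "(\<lambda>w. ln (\<sigma> w)) = (\<lambda>w. puncture_term k (ln (norm (w - p))) + puncture_term k (ln (norm (w - q))))"
      by (simp add: \<sigma>_def)
    ultimately show ?thesis using jet by (intro exI[of _ "a + b"] exI conjI) (simp_all only:)
  qed
  have \<sigma>_pos: "\<sigma> z > 0" for z by (simp add: \<sigma>_def)
  have \<tau>_less_\<sigma>: "\<tau> z < \<sigma> z" if "norm (z - p) = 1" "z \<noteq> q" for z
  proof -
    have "norm (z - q) \<le> 1 + D"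
      unfolding D_def using norm_triangle_ineq[of "z - p" "p - q"] that by simp
    then have "ln (norm (z - q)) \<le> ln (1 + D)" using that by (simp add: ln_mono)
    moreover have "0 \<le> ln (1 + exp (2 / 5 * s))" for s :: real by (simp add: ln_ge_zero)
    from this[of "ln (norm (z - p))"] this[of "ln (norm (z - q))"]
    have "2 * k - 4 / 5 * ln (norm (z - q)) \<le> puncture_term k (ln (norm (z - p))) + puncture_term k (ln (norm (z - q)))"
      using that(1) by (simp add: puncture_term_def)
    ultimately have "L \<le> \<sigma> z" unfolding L_def \<sigma>_def exp_le_cancel_iff by linarith
    moreover have "\<tau> z = 1 / C" using that(1) by (simp add: \<tau>_def punctured_disc_density_def)
    moreover have "1 / C < L" using L by (simp add: C_def field_simps)
    ultimately show ?thesis by linarith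
  qed
  show ?thesis
  proof (rule that[OF C, of \<mu>])
    show "punctured_disc_density C p z \<le> \<mu> z" for z by (simp add: \<mu>_def \<tau>_def)
    fix G assume G: "open G" "G \<noteq> {}" "p \<notin> G" "q \<notin> G"
    have \<sigma>_cont: "continuous_on G \<sigma>"
    proof -
      have "1 + exp (2 / 5 * t) \<noteq> 0" for t :: real
        using exp_gt_zero[of "2 / 5 * t"] by linarith
      then show ?thesis
        unfolding \<sigma>_def puncture_term_def using G by (intro continuous_intros) auto
    qed
    have "C + \<bar>t\<bar> \<noteq> 0" for t using C by linarith
    then have \<tau>_cont: "continuous_on G \<tau>"
      unfolding \<tau>_def punctured_disc_density_def using G by (intro continuous_intros) auto
    show "sk_metric G \<mu>"
    proof (rule sk_metricI_jet[OF G(1,2)])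
      show "continuous_on G \<mu>" unfolding \<mu>_def by (intro continuous_intros \<sigma>_cont \<tau>_cont)
      show "\<mu> z > 0" for z using \<sigma>_pos[of z] by (simp add: \<mu>_def)
      fix z assume z: "z \<in> G"
      then have zpq: "z \<noteq> p" "z \<noteq> q" using G by auto
      show "\<exists>v a q. has_jet (\<lambda>w. ln (v w)) z a q \<and> (\<mu> z)\<^sup>2 \<le> q \<and>
          continuous_on G v \<and> (\<forall>w\<in>G. 0 < v w \<and> v w \<le> \<mu> w) \<and> v z = \<mu> z"
      proof (cases "\<tau> z \<le> \<sigma> z")
        case True
        obtain a q' where "has_jet (\<lambda>w. ln (\<sigma> w)) z a q'" "(\<sigma> z)\<^sup>2 \<le> q'"
          using jet_\<sigma>[OF zpq] by blast
        then show ?thesis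
          using True \<sigma>_cont \<sigma>_pos by (intro exI[of _ \<sigma>]) (auto simp: \<mu>_def max_def)
      next
        case False
        then have "norm (z - p) \<noteq> 1" using \<tau>_less_\<sigma>[OF _ zpq(2)] by force
        then obtain a where "has_jet (\<lambda>w. ln (\<tau> w)) z a ((\<tau> z)\<^sup>2)"
          unfolding \<tau>_def using has_jet_punctured_disc_density[OF zpq(1) C] by blast
        moreover have "\<forall>w\<in>G. 0 < \<tau> w"
          unfolding \<tau>_def using G C by (auto intro!: punctured_disc_density_pos)
        ultimately show ?thesis
          using False \<tau>_cont by (intro exI[of _ \<tau>]) (auto simp: \<mu>_def max_def)
      qed
    qed
  qed
qed

section \<open>Ahlfors' lemma and bounds for the hyperbolic density\<close>

text \<open>
  The quotient of \<open>\<rho>\<close> and the hyperbolic density \<open>2 * R / (R\<^sup>2 - (norm (w - z))\<^sup>2)\<close> of the disc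
  vanishes on the boundary circle, so a positive maximum is attained at an interior point \<open>w0\<close>. There the
  maximum principle compares the two Laplacians, and the curvature bound makes the quotient at most
  \<open>1\<close>. Its value at the centre gives the claim.
\<close>

lemma sk_metric_le_disc:
  assumes sk: "sk_metric G \<rho>" and R: "R > 0" "cball z R \<subseteq> G"
  shows "\<rho> z \<le> 2 / R"
proof -
  have cont: "continuous_on G \<rho>" and nonneg: "\<And>w. w \<in> G \<Longrightarrow> 0 \<le> \<rho> w"
    and curv: "\<And>w. w \<in> G \<Longrightarrow> \<rho> w > 0 \<Longrightarrow> curvature \<rho> w \<le> -1"
    using sk unfolding sk_metric_def conformal_pseudo_metric_def by auto
  define A where "A w = R\<^sup>2 - (norm (w - z))\<^sup>2" for w
  have "continuous_on (cball z R) (\<lambda>w. \<rho> w * A w)"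
    unfolding A_def by (intro continuous_intros continuous_on_subset[OF cont] R)
  then obtain w0 where w0: "w0 \<in> cball z R" "\<And>w. w \<in> cball z R \<Longrightarrow> \<rho> w * A w \<le> \<rho> w0 * A w0"
    using continuous_attains_sup[of "cball z R" "\<lambda>w. \<rho> w * A w"] R by auto
  have zR: "\<rho> z * R\<^sup>2 \<le> \<rho> w0 * A w0"
    using w0(2)[of z] R by (simp add: A_def)
  have A_nn: "A w \<ge> 0" if "w \<in> cball z R" for w
    using that by (simp add: A_def dist_norm norm_minus_commute power_mono)
  have "\<rho> w0 * A w0 \<le> 2 * R"
  proof (cases "\<rho> w0 * A w0 = 0")
    case False
    then have pos: "\<rho> w0 > 0" "A w0 > 0"
      using nonneg[of w0] A_nn[OF w0(1)] w0(1) R by (auto simp: less_le)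
    then have "norm (w0 - z) < R"
      using R by (simp add: A_def power_less_imp_less_base)
    then have w0b: "w0 \<in> ball z R" by (simp add: dist_norm norm_minus_commute)
    have w0G: "w0 \<in> G" using w0(1) R(2) by blast
    have "continuous_on (ball z R) \<rho>" using R by (intro continuous_on_subset[OF cont]) auto
    then have "open (ball z R \<inter> \<rho> -` {0<..})"
      by (rule continuous_open_preimage) auto
    then have "open {w \<in> ball z R. 0 < \<rho> w}" by (simp add: vimage_def Int_def)
    moreover have "w0 \<in> {w \<in> ball z R. 0 < \<rho> w}" using pos w0b by simp
    ultimately obtain r where r: "r > 0" "cball w0 r \<subseteq> {w \<in> ball z R. 0 < \<rho> w}"
      by (meson open_contains_cball)
    have A_pos: "A w > 0" if "w \<in> ball z R" for w
      using that by (simp add: A_def dist_norm norm_minus_commute power_strict_mono)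
    have rG: "cball w0 r \<subseteq> G" using r R by force
    have jet: "has_jet (\<lambda>w. - ln (R\<^sup>2 - (norm (w - z))\<^sup>2)) w0
        (of_real (1 / (R\<^sup>2 - (norm (w0 - z))\<^sup>2)) * (2 * cnj (w0 - z)))
        (1 / (R\<^sup>2 - (norm (w0 - z))\<^sup>2) * 4 + 1 / (A w0)\<^sup>2 * (norm (2 * cnj (w0 - z)))\<^sup>2)"
    proof (rule has_jet_compose[OF has_jet_norm_sq, where f = "\<lambda>x. - ln (R\<^sup>2 - x)"
        and ?f1.0 = "\<lambda>x. 1 / (R\<^sup>2 - x)"])
      have "\<forall>\<^sub>F x in nhds ((norm (w0 - z))\<^sup>2). x \<in> {..<R\<^sup>2}"
        using pos(2) by (intro eventually_nhds_in_open) (auto simp: A_def)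
      then show "\<forall>\<^sub>F x in nhds ((norm (w0 - z))\<^sup>2). ((\<lambda>x. - ln (R\<^sup>2 - x)) has_real_derivative 1 / (R\<^sup>2 - x)) (at x)"
        by eventually_elim (auto intro!: derivative_eq_intros)
      show "((\<lambda>x. 1 / (R\<^sup>2 - x)) has_real_derivative 1 / (A w0)\<^sup>2) (at ((norm (w0 - z))\<^sup>2))"
        using pos(2) by (auto intro!: derivative_eq_intros simp: A_def power2_eq_square)
    qed
    have "gen_laplacian (\<lambda>w. ln (\<rho> w)) w0 \<le>
        ereal (1 / (R\<^sup>2 - (norm (w0 - z))\<^sup>2) * 4 + 1 / (A w0)\<^sup>2 * (norm (2 * cnj (w0 - z)))\<^sup>2)"
    proof (rule gen_laplacian_le_jet[OF jet r(1)], fold A_def)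
      show "continuous_on (cball w0 r) (\<lambda>w. ln (\<rho> w))"
        using r by (intro continuous_on_ln continuous_on_subset[OF cont rG]) force
      have "A w \<noteq> 0" if "w \<in> cball w0 r" for w using that A_pos[of w] r by force
      then show "continuous_on (cball w0 r) (\<lambda>w. - ln (A w))"
        unfolding A_def by (intro continuous_intros) auto
      fix w assume w: "w \<in> cball w0 r"
      then have wb: "w \<in> ball z R" "\<rho> w > 0" using r by auto
      then have "\<rho> w * A w \<le> \<rho> w0 * A w0" by (intro w0(2)) auto
      then have "ln (\<rho> w * A w) \<le> ln (\<rho> w0 * A w0)"
        using wb A_pos[OF wb(1)] by (intro ln_mono) auto
      then show "ln (\<rho> w) - ln (\<rho> w0) \<le> - ln (A w) - - ln (A w0)"
        using wb A_pos[OF wb(1)] pos by (simp add: ln_mult)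
    qed
    also have "1 / (R\<^sup>2 - (norm (w0 - z))\<^sup>2) * 4 + 1 / (A w0)\<^sup>2 * (norm (2 * cnj (w0 - z)))\<^sup>2
        = (2 * R / A w0)\<^sup>2"
    proof -
      have n: "(norm (2 * cnj (w0 - z)))\<^sup>2 = 4 * (R\<^sup>2 - A w0)"
        by (simp add: A_def norm_mult power_mult_distrib del: complex_cnj_diff)
      show ?thesis unfolding n A_def[symmetric] using pos(2)
        by (simp add: power2_eq_square field_simps)
    qed
    finally have "gen_laplacian (\<lambda>w. ln (\<rho> w)) w0 \<le> ereal ((2 * R / A w0)\<^sup>2)" .
    moreover have "ereal ((\<rho> w0)\<^sup>2) \<le> gen_laplacian (\<lambda>w. ln (\<rho> w)) w0"
      using curv[OF w0G pos(1)] curvature_le_minus_one_iff[of \<rho> w0, OF pos(1)] by (simp only:)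
    ultimately have "ereal ((\<rho> w0)\<^sup>2) \<le> ereal ((2 * R / A w0)\<^sup>2)" by (rule order.trans[rotated])
    then have "\<rho> w0 \<le> 2 * R / A w0"
      using pos R by (intro power2_le_imp_le[of "\<rho> w0"]) auto
    then show ?thesis using pos by (simp add: field_simps)
  qed (use R in auto)
  with zR have "\<rho> z * R\<^sup>2 \<le> 2 * R" by linarith
  then show ?thesis using R by (simp add: field_simps power2_eq_square)
qed

text \<open>
  With at least one SK-metric on \<open>G\<close>, the disc bound turns the supremum of the definition into a
  genuine one. The last equivalence is what makes the density lower semicontinuous.
\<close>

lemma hyperbolic_metric_bounds:
  assumes sk: "sk_metric G \<mu>" and R: "R > 0" "cball z R \<subseteq> G"
  shows "\<mu> z \<le> hyperbolic_metric G z" "hyperbolic_metric G z \<le> 2 / R" "0 \<le> hyperbolic_metric G z"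
    and "y < hyperbolic_metric G z \<longleftrightarrow> (\<exists>\<rho>. sk_metric G \<rho> \<and> y < \<rho> z)"
proof -
  let ?S = "{\<rho> z |\<rho>. sk_metric G \<rho>}"
  have ne: "?S \<noteq> {}" using sk by blast
  have bdd: "bdd_above ?S"
    using sk_metric_le_disc[OF _ R] by (intro bdd_aboveI[of _ "2 / R"]) auto
  show le: "\<mu> z \<le> hyperbolic_metric G z"
    unfolding hyperbolic_metric_def using sk bdd by (intro cSup_upper) auto
  show "hyperbolic_metric G z \<le> 2 / R"
    unfolding hyperbolic_metric_def using sk_metric_le_disc[OF _ R] ne by (intro cSup_least) auto
  have "z \<in> G" using R by auto
  then have "0 \<le> \<mu> z" using sk by (auto simp: sk_metric_def conformal_pseudo_metric_def)
  then show "0 \<le> hyperbolic_metric G z" using le by linarith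
  show "y < hyperbolic_metric G z \<longleftrightarrow> (\<exists>\<rho>. sk_metric G \<rho> \<and> y < \<rho> z)"
    unfolding hyperbolic_metric_def using less_cSup_iff[OF ne bdd, of y] by auto
qed

section \<open>Lengths of paths\<close>

text \<open>
  One-sided limits bound the derivative on one-sided neighbourhoods of each parameter; bisection
  (\<open>Bolzano\<close>) makes the bound global.
\<close>

lemma piecewise_C1_path_bounded_derivative:
  assumes "piecewise_C1_path \<gamma>"
  shows "bounded ((\<lambda>t. vector_derivative \<gamma> (at t)) ` {0..1})"
proof -
  let ?d = "\<lambda>t. vector_derivative \<gamma> (at t)"
  have lim: "\<forall>t\<in>{0<..1}. \<exists>l. (?d \<longlongrightarrow> l) (at_left t)" "\<forall>t\<in>{0..<1}. \<exists>l. (?d \<longlongrightarrow> l) (at_right t)"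
    using assms by (auto simp: piecewise_C1_path_def)
  have half: "\<exists>d>0. bounded (?d ` {s\<in>S. dist s t < d})" if "(?d \<longlongrightarrow> l) (at t within S)" for t l S
  proof -
    from tendstoD[OF that zero_less_one]
    obtain d where d: "d > 0" "\<And>s. s \<in> S \<Longrightarrow> s \<noteq> t \<Longrightarrow> dist s t < d \<Longrightarrow> dist (?d s) l < 1"
      unfolding eventually_at by blast
    have "?d s \<in> insert (?d t) (ball l 1)" if "s \<in> S" "dist s t < d" for s
      using d(2)[of s] that by (cases "s = t") (auto simp: dist_commute)
    then have "?d ` {s\<in>S. dist s t < d} \<subseteq> insert (?d t) (ball l 1)" by blast
    then have "bounded (?d ` {s\<in>S. dist s t < d})" by (rule bounded_subset[rotated]) simp
    then show ?thesis using d(1) by blast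
  qed
  have "bounded (?d ` ({0..1} \<inter> {0..1}))"
  proof (rule Bolzano[of 0 1 "\<lambda>a b. bounded (?d ` ({a..b} \<inter> {0..1}))"])
    fix a b c :: real
    assume "bounded (?d ` ({a..b} \<inter> {0..1}))" "bounded (?d ` ({b..c} \<inter> {0..1}))" "a \<le> b" "b \<le> c"
    moreover have "{a..c} \<inter> {0..1} \<subseteq> ({a..b} \<inter> {0..1}) \<union> ({b..c} \<inter> {0..1::real})" by auto
    ultimately show "bounded (?d ` ({a..c} \<inter> {0..1}))"
      by (metis (no_types, lifting) bounded_Un bounded_subset image_Un image_mono)
  next
    fix t :: real assume t: "0 \<le> t" "t \<le> 1"
    have "\<exists>d>0. bounded (?d ` ({s. dist s t < d \<and> s < t} \<inter> {0..1}))"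
    proof (cases "t = 0")
      case True
      then have "{s. dist s t < 1 \<and> s < t} \<inter> {0..1} = {}" by auto
      then show ?thesis by (intro exI[of _ 1]) simp
    next
      case False
      then obtain l where "(?d \<longlongrightarrow> l) (at_left t)" using lim t by force
      from half[OF this] obtain d where "d > 0" "bounded (?d ` {s\<in>{..<t}. dist s t < d})" by blast
      then show ?thesis by (intro exI[of _ d]) (auto elim!: bounded_subset)
    qed
    moreover have "\<exists>d>0. bounded (?d ` ({s. dist s t < d \<and> s > t} \<inter> {0..1}))"
    proof (cases "t = 1")
      case True
      then have "{s. dist s t < 1 \<and> s > t} \<inter> {0..1} = {}" by auto
      then show ?thesis by (intro exI[of _ 1]) simp
    next
      case False
      then obtain l where "(?d \<longlongrightarrow> l) (at_right t)" using lim t by force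
      from half[OF this] obtain d where "d > 0" "bounded (?d ` {s\<in>{t<..}. dist s t < d})" by blast
      then show ?thesis by (intro exI[of _ d]) (auto elim!: bounded_subset)
    qed
    ultimately obtain d1 d2 where d: "d1 > 0" "d2 > 0"
      "bounded (?d ` ({s. dist s t < d1 \<and> s < t} \<inter> {0..1}))"
      "bounded (?d ` ({s. dist s t < d2 \<and> s > t} \<inter> {0..1}))" by blast
    show "\<exists>d>0. \<forall>a b. a \<le> t \<and> t \<le> b \<and> b - a < d \<longrightarrow> bounded (?d ` ({a..b} \<inter> {0..1}))"
    proof (intro exI[of _ "min d1 d2"] conjI allI impI)
      fix a b assume ab: "a \<le> t \<and> t \<le> b \<and> b - a < min d1 d2"
      have "?d ` ({a..b} \<inter> {0..1}) \<subseteq> ?d ` ({s. dist s t < d1 \<and> s < t} \<inter> {0..1}) \<union>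
          (?d ` ({s. dist s t < d2 \<and> s > t} \<inter> {0..1}) \<union> {?d t})"
      proof
        fix y assume "y \<in> ?d ` ({a..b} \<inter> {0..1})"
        then obtain s where s: "s \<in> {a..b} \<inter> {0..1}" "y = ?d s" by blast
        consider "s < t" | "s > t" | "s = t" by linarith
        then show "y \<in> ?d ` ({s. dist s t < d1 \<and> s < t} \<inter> {0..1}) \<union>
          (?d ` ({s. dist s t < d2 \<and> s > t} \<inter> {0..1}) \<union> {?d t})"
          using s ab by cases (auto simp: dist_real_def)
      qed
      then show "bounded (?d ` ({a..b} \<inter> {0..1}))"
        by (rule bounded_subset[rotated]) (use d in simp)
    qed (use d in auto)
  qed simp
  then show ?thesis by simp
qed

text \<open>
  The Henstock--Kurzweil integral of a function that is not integrable is zero, so lower bounds for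
  lengths presuppose integrability. Lower semicontinuity of the density gives measurability of the
  integrand off the finite set where the path is not differentiable; compactness of the path gives
  a uniform disc inside \<open>G\<close> and thereby a bound.
\<close>

lemma hyperbolic_length_integrable:
  assumes G: "open G" and sk: "sk_metric G \<mu>"
    and \<gamma>: "piecewise_C1_path \<gamma>" "path_image \<gamma> \<subseteq> G"
  shows "(\<lambda>t. hyperbolic_metric G (\<gamma> t) * norm (vector_derivative \<gamma> (at t))) integrable_on {0..1}"
proof -
  let ?d = "\<lambda>t. vector_derivative \<gamma> (at t)"
  let ?h = "\<lambda>t. hyperbolic_metric G (\<gamma> t)"
  have vp: "valid_path \<gamma>" using \<gamma>(1) by (simp add: piecewise_C1_path_def)
  then have path: "continuous_on {0..1} \<gamma>"
    using valid_path_imp_path path_def by blast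
  obtain S where S: "finite S" "\<gamma> C1_differentiable_on {0..1} - S"
    using vp by (auto simp: valid_path_def piecewise_C1_differentiable_on_def)
  then have dcont: "continuous_on ({0..1} - S) ?d"
    by (simp add: C1_differentiable_on_eq)
  define T where "T = {0..1::real} - S"
  have T: "T \<in> sets lebesgue" "T \<subseteq> {0..1}"
    using S(1) by (auto simp: T_def intro!: sets.Diff borel_closed finite_imp_closed)
  have \<gamma>G: "\<gamma> t \<in> G" if "t \<in> T" for t
    using that \<gamma>(2) T(2) by (auto simp: path_image_def)
  have cb: "\<exists>R>0. cball w R \<subseteq> G" if "w \<in> G" for w
    using G that by (meson open_contains_cball)
  have meas_h: "?h \<in> borel_measurable (lebesgue_on T)"
  proof (rule borel_measurableI_greater)
    fix y
    have "{t \<in> T. y < ?h t} = (\<Union>\<rho>\<in>{\<rho>. sk_metric G \<rho>}. T \<inter> (\<lambda>t. \<rho> (\<gamma> t)) -` {y<..})"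
      using cb \<gamma>G hyperbolic_metric_bounds(4)[OF sk] by fastforce
    moreover have "openin (top_of_set T) (T \<inter> (\<lambda>t. \<rho> (\<gamma> t)) -` {y<..})" if "sk_metric G \<rho>" for \<rho>
    proof (rule continuous_openin_preimage_gen)
      have "continuous_on G \<rho>" using that by (auto simp: sk_metric_def conformal_pseudo_metric_def)
      then show "continuous_on T (\<lambda>t. \<rho> (\<gamma> t))"
        using continuous_on_subset[OF path T(2)] by (rule continuous_on_compose2) (use \<gamma>G in auto)
    qed auto
    then have "openin (top_of_set T) (\<Union>\<rho>\<in>{\<rho>. sk_metric G \<rho>}. T \<inter> (\<lambda>t. \<rho> (\<gamma> t)) -` {y<..})"
      by (intro openin_Union) blast
    ultimately have "openin (top_of_set T) {t \<in> T. y < ?h t}" by (simp only:)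
    then show "{t \<in> space (lebesgue_on T). y < ?h t} \<in> sets (lebesgue_on T)"
      using lebesgue_openin[OF _ T(1)] T(1) by (auto simp: sets_restrict_space_iff)
  qed
  have meas_d: "(\<lambda>t. norm (?d t)) \<in> borel_measurable (lebesgue_on T)"
    using dcont T(1) unfolding T_def
    by (intro continuous_imp_measurable_on_sets_lebesgue continuous_intros)
  obtain B where B: "\<And>t. t \<in> {0..1} \<Longrightarrow> norm (?d t) \<le> B"
    using piecewise_C1_path_bounded_derivative[OF \<gamma>(1)] unfolding bounded_iff by blast
  have "compact (path_image \<gamma>)"
    using path by (simp add: compact_path_image path_def)
  then obtain R where R: "R > 0" "\<And>w. w \<in> path_image \<gamma> \<Longrightarrow> cball w R \<subseteq> G"
    using compact_subset_open_imp_cball_epsilon_subset[OF _ G \<gamma>(2)] by (metis UN_subset_iff)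
  have bound: "norm (?h t * norm (?d t)) \<le> 2 / R * B" if "t \<in> T" for t
  proof -
    have t: "t \<in> {0..1}" "cball (\<gamma> t) R \<subseteq> G"
      using that T(2) R(2) by (auto simp: path_image_def)
    show ?thesis
      using hyperbolic_metric_bounds(2,3)[OF sk R(1) t(2)] B[OF t(1)] R(1)
      by (simp add: abs_mult del: times_divide_eq_left) (intro mult_mono, auto)
  qed
  have "negligible S" using S(1) by (rule negligible_finite)
  then have ae: "negligible ({0..1} - T)" "negligible (T - {0..1})"
    by (auto simp: T_def intro: negligible_subset[of S])
  have "(\<lambda>t. ?h t * norm (?d t)) integrable_on T"
  proof (rule measurable_bounded_by_integrable_imp_integrable[OF _ _ bound T(1)])
    show "(\<lambda>t. ?h t * norm (?d t)) \<in> borel_measurable (lebesgue_on T)"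
      using meas_h meas_d by measurable
    have "(\<lambda>t. 2 / R * B) integrable_on {0..1::real}" by (rule integrable_const_ivl)
    then show "(\<lambda>t. 2 / R * B) integrable_on T"
      using ae by (subst integrable_spike_set_eq[of T "{0..1}"]) (auto simp: negligible_Un sup_commute)
  qed
  then show ?thesis
    using ae by (subst integrable_spike_set_eq[of "{0..1}" T]) (auto simp: negligible_Un)
qed

text \<open>
  A function whose gradient is at most the density is 1-Lipschitz for the conformal distance.
\<close>

lemma conformal_length_ge_potential:
  assumes \<gamma>: "piecewise_C1_path \<gamma>" "path_image \<gamma> \<subseteq> G"
    and int: "(\<lambda>t. \<rho> (\<gamma> t) * norm (vector_derivative \<gamma> (at t))) integrable_on {0..1}"
    and \<Phi>: "\<And>z. z \<in> G \<Longrightarrow> (\<Phi> has_derivative \<Phi>' z) (at z)"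
    and bound: "\<And>z v. z \<in> G \<Longrightarrow> \<bar>\<Phi>' z v\<bar> \<le> \<rho> z * norm v"
  shows "\<bar>\<Phi> (pathfinish \<gamma>) - \<Phi> (pathstart \<gamma>)\<bar> \<le> conformal_length \<rho> \<gamma>"
proof -
  let ?d = "\<lambda>t. vector_derivative \<gamma> (at t)"
  have vp: "valid_path \<gamma>" using \<gamma>(1) by (simp add: piecewise_C1_path_def)
  then have path: "continuous_on {0..1} \<gamma>"
    using valid_path_imp_path path_def by blast
  obtain S where S: "finite S" "\<gamma> C1_differentiable_on {0..1} - S"
    using vp by (auto simp: valid_path_def piecewise_C1_differentiable_on_def)
  have \<gamma>G: "\<gamma> t \<in> G" if "t \<in> {0..1}" for t
    using that \<gamma>(2) by (auto simp: path_image_def)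
  have \<Phi>_cont: "continuous_on G \<Phi>"
    using \<Phi> by (meson continuous_at_imp_continuous_on has_derivative_continuous)
  have FTC: "((\<lambda>t. \<Phi>' (\<gamma> t) (?d t)) has_integral (\<Phi> (\<gamma> 1) - \<Phi> (\<gamma> 0))) {0..1}"
  proof (rule fundamental_theorem_of_calculus_strong[OF S(1), of _ _ "\<lambda>t. \<Phi> (\<gamma> t)"])
    show "continuous_on {0..1} (\<lambda>t. \<Phi> (\<gamma> t))"
      using \<Phi>_cont path by (rule continuous_on_compose2) (use \<gamma>G in auto)
    fix t assume t: "t \<in> {0..1} - S"
    then have "(\<gamma> has_vector_derivative ?d t) (at t)"
      using S(2) by (auto simp: C1_differentiable_on_eq vector_derivative_works)
    then have "(\<gamma> has_derivative (\<lambda>x. x *\<^sub>R ?d t)) (at t)"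
      by (simp add: has_vector_derivative_def)
    moreover have \<Phi>d: "(\<Phi> has_derivative \<Phi>' (\<gamma> t)) (at (\<gamma> t))" using t \<gamma>G by (intro \<Phi>) auto
    ultimately have "((\<lambda>t. \<Phi> (\<gamma> t)) has_derivative (\<lambda>x. \<Phi>' (\<gamma> t) (x *\<^sub>R ?d t))) (at t)"
      by (rule has_derivative_compose)
    moreover have "linear (\<Phi>' (\<gamma> t))" using \<Phi>d by (rule has_derivative_linear)
    ultimately show "((\<lambda>t. \<Phi> (\<gamma> t)) has_vector_derivative \<Phi>' (\<gamma> t) (?d t)) (at t)"
      by (simp add: has_vector_derivative_def linear_cmul)
  qed simp
  have "norm (integral {0..1} (\<lambda>t. \<Phi>' (\<gamma> t) (?d t))) \<le> conformal_length \<rho> \<gamma>"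
    unfolding conformal_length_def
    using FTC int bound \<gamma>G by (intro integral_norm_bound_integral) auto
  then show ?thesis
    using integral_unique[OF FTC] by (simp add: pathfinish_def pathstart_def)
qed

text \<open>
  Keeps the infimum that defines the conformal distance away from the empty set.
\<close>

lemma exists_piecewise_C1_path:
  assumes "open G" "connected G" "x \<in> G" "y \<in> G"
  shows "\<exists>\<gamma>. piecewise_C1_path \<gamma> \<and> path_image \<gamma> \<subseteq> G \<and> pathstart \<gamma> = x \<and> pathfinish \<gamma> = y"
proof -
  obtain g :: "real \<Rightarrow> complex" where g: "polynomial_function g" "path_image g \<subseteq> G" "pathstart g = x" "pathfinish g = y"
    using connected_open_polynomial_connected[OF assms] by blast
  obtain g' where g': "polynomial_function g'" "\<And>t. (g has_vector_derivative g' t) (at t)"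
    using has_vector_derivative_polynomial_function[OF g(1)] by blast
  have cont: "continuous_on UNIV g" "continuous_on UNIV g'"
    using g(1) g'(1) by (simp_all add: continuous_on_polymonial_function)
  have "valid_path g"
    unfolding valid_path_def piecewise_C1_differentiable_on_def C1_differentiable_on_def
    using g'(2) continuous_on_subset[OF cont(1)] continuous_on_subset[OF cont(2)] by blast
  moreover have "(\<lambda>s. vector_derivative g (at s)) = g'"
    using g'(2) by (auto simp: vector_derivative_at)
  moreover have "(g' \<longlongrightarrow> g' t) (at t within T)" for t T
    using continuous_on_subset[OF cont(2)] cont(2)
    by (metis UNIV_I continuous_on_def tendsto_within_subset subset_UNIV)
  ultimately have "piecewise_C1_path g"
    unfolding piecewise_C1_path_def by metis
  then show ?thesis using g by blast
qed

section \<open>Completeness\<close>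

text \<open>
  A smooth substitute for \<open>ln (C + \<bar>ln r\<bar>)\<close>, which is the distance function of the punctured disc
  density but has a kink at \<open>r = 1\<close>. The factor \<open>1/3\<close> keeps its gradient below that density.
\<close>

definition escape_potential :: "real \<Rightarrow> complex \<Rightarrow> complex \<Rightarrow> real" where
  "escape_potential C p z = ln (C\<^sup>2 + (ln (norm (z - p)))\<^sup>2) / 3"

lemma escape_potential_derivative:
  assumes "z \<noteq> p" "C > 0"
  shows "\<exists>D. (escape_potential C p has_derivative D) (at z) \<and>
    (\<forall>v. \<bar>D v\<bar> \<le> punctured_disc_density C p z * norm v)"
proof -
  define s where "s = ln (norm (z - p))"
  have pos: "C\<^sup>2 + s\<^sup>2 > 0" using assms(2) by (simp add: add_pos_nonneg)
  define n where "n = norm (z - p)"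
  have n: "n > 0" "s = ln n" using assms(1) by (simp_all add: n_def s_def)
  define D where "D v = 2 * s / n / (C\<^sup>2 + s\<^sup>2) / 3 * (v \<bullet> sgn (z - p))" for v
  have f: "((\<lambda>t. ln (C\<^sup>2 + (ln t)\<^sup>2) / 3) has_real_derivative 2 * s / n / (C\<^sup>2 + s\<^sup>2) / 3) (at n)"
    using n pos by (auto intro!: derivative_eq_intros)
  have "((\<lambda>w. norm (w - p)) has_derivative (\<lambda>v. v \<bullet> sgn (z - p))) (at z)"
    using assms(1) by (intro has_derivative_compose[OF _ has_derivative_norm])
      (auto intro!: derivative_eq_intros)
  from has_derivative_compose[OF this f[unfolded has_field_derivative_def n_def]]
  have "(escape_potential C p has_derivative D) (at z)"
    unfolding escape_potential_def[abs_def] D_def n_def by simp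
  moreover have "\<bar>D v\<bar> \<le> punctured_disc_density C p z * norm v" for v
  proof -
    have "\<bar>v \<bullet> sgn (z - p)\<bar> \<le> norm v"
      using Cauchy_Schwarz_ineq2[of v "sgn (z - p)"] assms(1) by (simp add: norm_sgn)
    then have "\<bar>v \<bullet> sgn (z - p)\<bar> / norm (z - p) \<le> norm v / norm (z - p)"
      by (rule divide_right_mono) simp
    moreover have "2 * \<bar>s\<bar> / (C\<^sup>2 + s\<^sup>2) / 3 \<le> 1 / (C + \<bar>s\<bar>)"
    proof -
      have "2 * x * (C + x) \<le> 3 * (C\<^sup>2 + x\<^sup>2)" for x
      proof -
        have "2 * (x * C) \<le> C\<^sup>2 + x\<^sup>2"
          using zero_le_power2[of "C - x"] by (simp add: power2_diff algebra_simps)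
        then have "2 * (x * C) + 2 * x\<^sup>2 \<le> 3 * (C\<^sup>2 + x\<^sup>2)"
          using zero_le_power2[of C] zero_le_power2[of x] unfolding distrib_left by linarith
        moreover have "2 * x * (C + x) = 2 * (x * C) + 2 * x\<^sup>2"
          by (simp add: power2_eq_square algebra_simps)
        ultimately show ?thesis by (simp only:)
      qed
      from this[of "\<bar>s\<bar>"] have "2 * \<bar>s\<bar> * (C + \<bar>s\<bar>) \<le> 3 * (C\<^sup>2 + s\<^sup>2)"
        unfolding power2_abs .
      then have "2 * \<bar>s\<bar> / (3 * (C\<^sup>2 + s\<^sup>2)) \<le> 1 / (C + \<bar>s\<bar>)"
        using pos assms(2) by (subst frac_le_eq) (auto simp: divide_le_0_iff zero_less_mult_iff)
      then show ?thesis by (simp add: mult.commute)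
    qed
    ultimately have "2 * \<bar>s\<bar> / (C\<^sup>2 + s\<^sup>2) / 3 * (\<bar>v \<bullet> sgn (z - p)\<bar> / n)
        \<le> 1 / (C + \<bar>s\<bar>) * (norm v / n)"
      unfolding n_def using assms(2) by (intro mult_mono) auto
    moreover have "\<bar>D v\<bar> = 2 * \<bar>s\<bar> / (C\<^sup>2 + s\<^sup>2) / 3 * (\<bar>v \<bullet> sgn (z - p)\<bar> / n)"
      using pos n(1) by (simp add: D_def abs_mult abs_divide)
    moreover have "1 / (C + \<bar>s\<bar>) * (norm v / n) = punctured_disc_density C p z * norm v"
      by (simp add: punctured_disc_density_def s_def n_def)
    ultimately show ?thesis by (simp only:)
  qed
  ultimately show ?thesis by blast
qed

text \<open>
  The hyperbolic density dominates the SK-density of the plane punctured at \<open>p\<close> and \<open>q\<close>, hence the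
  punctured disc density, hence the gradient of the escape potential.
\<close>

lemma hyperbolic_dist_ge_escape_potential:
  assumes G: "plane_domain G" and pq: "p \<noteq> q" "p \<notin> G" "q \<notin> G"
  obtains C where "C > 0" "\<And>z0 z1. z0 \<in> G \<Longrightarrow> z1 \<in> G \<Longrightarrow>
    escape_potential C p z1 - escape_potential C p z0 \<le> conformal_dist G (hyperbolic_metric G) z1 z0"
proof -
  have G': "open G" "connected G" "G \<noteq> {}" using G by (auto simp: plane_domain_def)
  obtain C \<mu> where C: "C > 0"
    and \<mu>: "\<And>z. z \<noteq> p \<Longrightarrow> z \<noteq> q \<Longrightarrow> punctured_disc_density C p z \<le> \<mu> z"
    and sk: "sk_metric G \<mu>"
    using exists_sk_metric_twice_punctured[OF pq(1)] G' pq by metis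
  have dens: "punctured_disc_density C p z \<le> hyperbolic_metric G z" if z: "z \<in> G" for z
  proof -
    obtain R where "R > 0" "cball z R \<subseteq> G" using G'(1) z by (meson open_contains_cball)
    then have "\<mu> z \<le> hyperbolic_metric G z" by (rule hyperbolic_metric_bounds(1)[OF sk])
    moreover have "punctured_disc_density C p z \<le> \<mu> z" using z pq by (intro \<mu>) auto
    ultimately show ?thesis by linarith
  qed
  have "\<forall>z\<in>G. \<exists>D. (escape_potential C p has_derivative D) (at z) \<and>
      (\<forall>v. \<bar>D v\<bar> \<le> punctured_disc_density C p z * norm v)"
  proof
    fix z assume "z \<in> G"
    then have "z \<noteq> p" using pq by blast
    then show "\<exists>D. (escape_potential C p has_derivative D) (at z) \<and>
        (\<forall>v. \<bar>D v\<bar> \<le> punctured_disc_density C p z * norm v)"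
      using C by (rule escape_potential_derivative)
  qed
  from bchoice[OF this]
  obtain D where D: "\<And>z. z \<in> G \<Longrightarrow> (escape_potential C p has_derivative D z) (at z)"
    "\<And>z v. z \<in> G \<Longrightarrow> \<bar>D z v\<bar> \<le> punctured_disc_density C p z * norm v"
    by blast
  have D': "\<bar>D z v\<bar> \<le> hyperbolic_metric G z * norm v" if "z \<in> G" for z v
    using D(2)[OF that, of v] mult_right_mono[OF dens[OF that], of "norm v"] by simp
  show ?thesis
  proof (rule that[OF C])
    fix z0 z1 assume z: "z0 \<in> G" "z1 \<in> G"
    show "escape_potential C p z1 - escape_potential C p z0 \<le> conformal_dist G (hyperbolic_metric G) z1 z0"
      unfolding conformal_dist_def
    proof (rule cInf_greatest)
      show "{conformal_length (hyperbolic_metric G) \<gamma> |\<gamma>. piecewise_C1_path \<gamma> \<and> path_image \<gamma> \<subseteq> G \<and>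
          pathstart \<gamma> = z1 \<and> pathfinish \<gamma> = z0} \<noteq> {}"
        using exists_piecewise_C1_path[OF G'(1,2) z(2,1)] by blast
    next
      fix x assume "x \<in> {conformal_length (hyperbolic_metric G) \<gamma> |\<gamma>. piecewise_C1_path \<gamma> \<and> path_image \<gamma> \<subseteq> G \<and>
          pathstart \<gamma> = z1 \<and> pathfinish \<gamma> = z0}"
      then obtain \<gamma> where \<gamma>: "x = conformal_length (hyperbolic_metric G) \<gamma>" "piecewise_C1_path \<gamma>"
        "path_image \<gamma> \<subseteq> G" "pathstart \<gamma> = z1" "pathfinish \<gamma> = z0" by blast
      have "\<bar>escape_potential C p (pathfinish \<gamma>) - escape_potential C p (pathstart \<gamma>)\<bar> \<le> x"
        unfolding \<gamma>(1) using conformal_length_ge_potential[OF \<gamma>(2,3)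
          hyperbolic_length_integrable[OF G'(1) sk \<gamma>(2,3)] D(1) D'] by blast
      then show "escape_potential C p z1 - escape_potential C p z0 \<le> x"
        unfolding \<gamma>(4,5) by linarith
    qed
  qed
qed

lemma escape_potential_le_imp_bounds:
  assumes "C > 0"
  obtains L where "\<And>z. z \<noteq> p \<Longrightarrow> escape_potential C p z \<le> M \<Longrightarrow> exp (- L) \<le> norm (z - p) \<and> norm (z - p) \<le> exp L"
proof -
  define L where "L = sqrt (exp (3 * M))"
  show ?thesis
  proof (rule that[of L])
    fix z assume z: "z \<noteq> p" "escape_potential C p z \<le> M"
    define s where "s = ln (norm (z - p))"
    have pos: "C\<^sup>2 + s\<^sup>2 > 0" using assms by (simp add: add_pos_nonneg)
    have "ln (C\<^sup>2 + s\<^sup>2) \<le> 3 * M" using z(2) by (simp add: escape_potential_def s_def)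
    then have "C\<^sup>2 + s\<^sup>2 \<le> exp (3 * M)" using pos by (metis exp_le_cancel_iff exp_ln)
    then have "s\<^sup>2 \<le> exp (3 * M)" using zero_le_power2[of C] by linarith
    then have "\<bar>s\<bar> \<le> L" unfolding L_def by (rule real_le_rsqrt[OF _, of "\<bar>s\<bar>", simplified])
    then have "exp (- L) \<le> exp s" "exp s \<le> exp L" by auto
    then show "exp (- L) \<le> norm (z - p) \<and> norm (z - p) \<le> exp L"
      using z(1) by (simp add: s_def)
  qed
qed

text \<open>
  If the distances did not tend to infinity, a subsequence would have bounded distance to the base
  point. It stays bounded because the potential of a first omitted point \<open>a\<close> grows at infinity, so it
  accumulates at some \<open>p\<close>, and \<open>p\<close> lies outside \<open>G\<close> because the sequence leaves every compact
  subset. The potential of \<open>p\<close> itself then contradicts convergence to \<open>p\<close>.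
\<close>

lemma complete_hyperbolic_metric:
  assumes G: "plane_domain G" and ab: "a \<in> frontier G" "b \<in> frontier G" "a \<noteq> b"
  shows "complete_conformal_metric G (hyperbolic_metric G)"
  unfolding complete_conformal_metric_def
proof (intro ballI allI impI, elim conjE)
  fix z0 and z :: "nat \<Rightarrow> complex"
  assume z0: "z0 \<in> G" and z: "\<forall>n. z n \<in> G"
    and leave: "\<forall>K. compact K \<and> K \<subseteq> G \<longrightarrow> (\<forall>\<^sub>F n in sequentially. z n \<notin> K)"
  let ?d = "\<lambda>n. conformal_dist G (hyperbolic_metric G) (z n) z0"
  have G': "open G" using G by (simp add: plane_domain_def)
  then have notin: "a \<notin> G" "b \<notin> G" using ab by (auto simp: frontier_def interior_open)
  \<comment> \<open>Points at bounded distance from the base point stay away from every omitted value and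
    from infinity.\<close>
  have stay: "\<exists>L. \<forall>n. ?d n \<le> M \<longrightarrow> exp (- L) \<le> norm (z n - p) \<and> norm (z n - p) \<le> exp L"
    if pq: "p \<noteq> q" "p \<notin> G" "q \<notin> G" for p q M
  proof -
    obtain C where C: "C > 0" "\<And>z0 z1. z0 \<in> G \<Longrightarrow> z1 \<in> G \<Longrightarrow>
      escape_potential C p z1 - escape_potential C p z0 \<le> conformal_dist G (hyperbolic_metric G) z1 z0"
      using hyperbolic_dist_ge_escape_potential[OF G pq] by metis
    obtain L where L: "\<And>z. z \<noteq> p \<Longrightarrow> escape_potential C p z \<le> M + escape_potential C p z0 \<Longrightarrow>
        exp (- L) \<le> norm (z - p) \<and> norm (z - p) \<le> exp L"
      using escape_potential_le_imp_bounds[OF C(1)] by metis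
    have "exp (- L) \<le> norm (z n - p) \<and> norm (z n - p) \<le> exp L" if n: "?d n \<le> M" for n
    proof (rule L)
      show "z n \<noteq> p" using z pq(2) by metis
      show "escape_potential C p (z n) \<le> M + escape_potential C p z0"
        using C(2)[OF z0 z[rule_format, of n]] n by linarith
    qed
    then show ?thesis by blast
  qed
  show "filterlim ?d at_top sequentially"
  proof (rule ccontr)
    assume "\<not> filterlim ?d at_top sequentially"
    then obtain M where "\<not> (\<forall>\<^sub>F n in sequentially. M \<le> ?d n)"
      unfolding filterlim_at_top by blast
    then have "\<exists>\<^sub>F n in sequentially. ?d n \<le> M"
      unfolding not_eventually by (rule frequently_elim1) simp
    then have "infinite {n. ?d n \<le> M}"
      by (simp add: frequently_cofinite[symmetric] cofinite_eq_sequentially)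
    then obtain r :: "nat \<Rightarrow> nat" where r: "strict_mono r" "\<And>n. ?d (r n) \<le> M"
      using infinite_enumerate by blast
    obtain L where L: "\<And>n. norm (z (r n) - a) \<le> exp L"
      using stay[OF ab(3) notin, of M] r(2) by blast
    have "bounded (range (z \<circ> r))"
      by (rule bounded_subset[OF bounded_cball[of a "exp L"]])
        (use L in \<open>auto simp: dist_norm norm_minus_commute\<close>)
    then obtain p k where pk: "strict_mono k" "(\<lambda>n. z (r (k n))) \<longlonglongrightarrow> p"
      using bounded_imp_convergent_subsequence[of "z \<circ> r"] by (auto simp: o_def)
    have rk: "filterlim (\<lambda>n. r (k n)) sequentially sequentially"
      using filterlim_subseq[OF strict_mono_o[OF r(1) pk(1)]] by (simp add: o_def)
    have "p \<notin> G"
    proof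
      assume "p \<in> G"
      then obtain e where e: "e > 0" "cball p e \<subseteq> G" using G' by (meson open_contains_cball)
      have "\<forall>\<^sub>F n in sequentially. z n \<notin> cball p e"
        using leave[rule_format, OF conjI[OF compact_cball e(2)]] by blast
      then have "\<forall>\<^sub>F n in sequentially. z (r (k n)) \<notin> cball p e"
        using rk by (rule eventually_compose_filterlim)
      moreover have "\<forall>\<^sub>F n in sequentially. dist (z (r (k n))) p < e"
        using pk(2) e(1) by (rule tendstoD)
      ultimately have "\<forall>\<^sub>F n in sequentially. False"
        by eventually_elim (simp add: dist_commute)
      then show False by simp
    qed
    moreover obtain q where "q \<noteq> p" "q \<notin> G" using notin ab(3) by metis
    ultimately obtain L' where L': "\<And>n. exp (- L') \<le> norm (z (r (k n)) - p)"
      using stay[of p q M] r(2) by metis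
    have "\<forall>\<^sub>F n in sequentially. dist (z (r (k n))) p < exp (- L')"
      using pk(2) by (rule tendstoD) simp
    then have "\<forall>\<^sub>F n in sequentially. False"
    proof eventually_elim
      case (elim n)
      then show ?case using L'[of n] by (simp add: dist_norm)
    qed
    then show False by simp
  qed
qed

theorem theorem4p23:
  shows "complete_conformal_metric (UNIV - {0, 1}) (hyperbolic_metric (UNIV - {0, 1})) \<and>
    (\<forall>G. plane_domain G \<and> (\<exists>a b. a \<in> frontier G \<and> b \<in> frontier G \<and> a \<noteq> b) \<longrightarrow>
      complete_conformal_metric G (hyperbolic_metric G))"
proof
  have "open (UNIV - {0, 1 :: complex})" by (simp add: open_Diff)
  moreover have "connected (UNIV - {0, 1 :: complex})"
    by (rule connected_open_diff_countable) auto
  ultimately have "plane_domain (UNIV - {0, 1})"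
    unfolding plane_domain_def by (metis Diff_eq_empty_iff finite.emptyI finite.insertI finite_subset infinite_UNIV_char_0)
  moreover have "frontier (UNIV - {0, 1 :: complex}) = {0, 1}"
  proof -
    have "frontier (UNIV - {0, 1 :: complex}) = frontier {0, 1}"
      using frontier_complement[of "{0, 1 :: complex}"] by (simp add: Compl_eq_Diff_UNIV)
    also have "\<dots> = {0, 1}"
      by (simp add: frontier_def closure_closed finite_imp_closed empty_interior_finite)
    finally show ?thesis .
  qed
  ultimately show "complete_conformal_metric (UNIV - {0, 1}) (hyperbolic_metric (UNIV - {0, 1}))"
    by (intro complete_hyperbolic_metric[of _ 0 1]) auto
  show "\<forall>G. plane_domain G \<and> (\<exists>a b. a \<in> frontier G \<and> b \<in> frontier G \<and> a \<noteq> b) \<longrightarrow>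
      complete_conformal_metric G (hyperbolic_metric G)"
    using complete_hyperbolic_metric by blast
qed

end
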